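(* Assume the following. (i) $\phi$ (and hence $l(\cdot,y)$) is differentiable and convex; there is $M>0$ with $|\partial_\zeta l(\zeta,y)|\le M$ for all $\zeta\in\mathbb{R}$, $y\in\{-1,1\}$; and $\mathcal{L}$ is $L$-smooth for some $L>0$, i.e. $|\mathcal{L}(g+h)-\mathcal{L}(g)-\langle\nabla\mathcal{L}(g),h\rangle_{\mathcal{H}_k}|\le \frac{L}{2}\|h\|_{\mathcal{H}_k}^2$ for all $g,h\in\mathcal{H}_k$. (ii) $\mathrm{supp}(\rho_{\mathcal{X}})=\mathcal{X}$ and there is $R>0$ with $k(x,x)\le R^2$ for all $x\in\mathcal{X}$. (iii) There is $\delta\in(0,1/2)$ such that $|\rho(1|x)-\frac12|>\delta$ for $\rho_{\mathcal{X}}$-almost every $x$. (iv) $\rho(1|X)\in(0,1)$ $\rho_{\mathcal{X}}$-almost surely; the link function $h_*$ is well-defined, differentiable, monotonically increasing and invertible over $(0,1)$; and $\mathrm{sgn}(\mu-1/2)=\mathrm{sgn}(h_*(\mu))$ for $\mu\in(0,1)$. (v) The Bregman divergence $d_{l_*}$ is positive, i.e. $d_{l_*}(\eta_1,\eta_2)=0$ if and only if $\eta_1=\eta_2$; and a Bayes rule $g_*$ for $\mathcal{L}$, unique up to $\rho_{\mathcal{X}}$-null sets, exists in $\mathcal{H}_k$. Then there exists a sufficiently small $\lambda>0$ such that the following holds. Run averaged stochastic gradient descent on $\mathcal{L}_\lambda$ with $\eta_t=\frac{2}{\lambda(\gamma+t)}$ and $\alpha_t=\frac{2(\gamma+t-1)}{(2\gamma+T)(T+1)}$,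 where $\gamma>0$ is such that $\eta_1\le\min\{\frac1L,\frac1{2\lambda}\}$, and assume $\|g_1\|_{\mathcal{H}_k}\le(2\eta_1+\frac1\lambda)MR$. Then for every sufficiently large $T$ such that $$\max\left\{\frac{36M^2R^2}{\lambda^2(2\gamma+T)},\ \frac{\gamma(\gamma-1)\|g_1-g_\lambda\|_{\mathcal{H}_k}^2}{(2\gamma+T)(T+1)}\right\}\le\frac{m^2(\delta)}{32R^2},$$ the averaged iterate $\overline{g}_{T+1}=\sum_{t=1}^{T+1}\alpha_tg_t$ satisfies $$\mathbb{E}\big[\mathcal{R}(\overline{g}_{T+1})-\mathcal{R}(\mathbb{E}[Y|x])\big]\le 2\exp\left(-\frac{m^2(\delta)\lambda^2(2\gamma+T)}{2^{10}\cdot 9\,M^2R^4}\right),$$ where the outer expectation is over the samples $z_1,\dots,z_T$.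
   Context: Setting: $\mathcal{X}$ is a measurable feature space (with a topology for which the support of a measure makes sense), $\mathcal{Y}=\{-1,1\}$, $\rho$ is a probability measure on $\mathcal{X}\times\mathcal{Y}$ with marginal $\rho_{\mathcal{X}}$ on $\mathcal{X}$ and conditional distribution $\rho(\cdot|x)$ on $\mathcal{Y}$; $Z=(X,Y)\sim\rho$. $\mathcal{H}_k$ is the reproducing kernel Hilbert space of a real-valued kernel $k$ on $\mathcal{X}$, with inner product $\langle\cdot,\cdot\rangle_{\mathcal{H}_k}$ and norm $\|\cdot\|_{\mathcal{H}_k}$. Loss: $\phi:\mathbb{R}\to\mathbb{R}$ is a non-negative convex function and $l(\zeta,y)=\phi(y\zeta)$; $\partial_\zeta l$ is the derivative in the first variable. Risks: $\mathcal{L}(g)=\mathbb{E}[l(g(X),Y)]$ and $\mathcal{L}_\lambda(g)=\mathcal{L}(g)+\frac{\lambda}{2}\|g\|_{\mathcal{H}_k}^2$; $\nabla$ is the gradient in $\mathcal{H}_k$; $g_\lambda$ is the minimizer of $\mathcal{L}_\lambda$ over $\mathcal{H}_k$. A Bayes rule $g_*$ for $\mathcal{L}$ is a minimizer of $\mathcal{L}$ over all measurable functions $\mathcal{X}\to\mathbb{R}$. Expected classification error: $\mathcal{R}(g)=\mathbb{E}_{(X,Y)\sim\rho}[I(\mathrm{sgn}(g(X)),Y)]$, where $I(y,y')=1$ if $y\ne y'$ and $0$ if $y=y'$. $\mathcal{R}(\mathbb{E}[Y|x])$ denotes $\mathcal{R}$ of the function $x\mapsto\mathbb{E}[Y|x]=2\rho(1|x)-1$,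 which minimizes $\mathcal{R}$ over all measurable functions. For $\mu\in(0,1)$: $h_*(\mu)=\arg\min_{h\in\mathbb{R}}\{\mu\phi(h)+(1-\mu)\phi(-h)\}$ (the link function) and $l_*(\mu)=\min_{h\in\mathbb{R}}\{\mu\phi(h)+(1-\mu)\phi(-h)\}$, which is concave. $d_{l_*}(\eta_1,\eta_2)=-l_*(\eta_2)+l_*(\eta_1)+l_*'(\eta_1)(\eta_2-\eta_1)$. $m(\delta)=\min\{h_*(0.5+\delta),|h_*(0.5-\delta)|\}$. Averaged stochastic gradient descent: $G_\lambda(g,z)=\partial_\zeta l(g(x),y)k(x,\cdot)+\lambda g$ for $z=(x,y)$. From a (deterministic) initial function $g_1\in\mathcal{H}_k$, for $t=1,\dots,T$ draw $z_t=(x_t,y_t)\sim\rho$ independently and set $g_{t+1}=g_t-\eta_tG_\lambda(g_t,z_t)$; the output is the weighted average $\overline{g}_{T+1}=\sum_{t=1}^{T+1}\alpha_tg_t$. *)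

theory Defs
  imports "HOL-Probability.Probability"
begin

text \<open>
  Reproducing kernel Hilbert spaces. The space is a complete inner product type \<open>'h\<close> together
  with an evaluation map \<open>fn :: 'h \<Rightarrow> ('x \<Rightarrow> real)\<close>, which is linear for the pointwise operations
  and injective, so that \<open>'h\<close> is identified with a linear space of functions on \<open>'x\<close>.
  Under this identification \<open>section_at fn k x\<close> is the element \<open>k(x, \<cdot>)\<close>.
\<close>

definition section_at :: "('h \<Rightarrow> 'x \<Rightarrow> real) \<Rightarrow> ('x \<Rightarrow> 'x \<Rightarrow> real) \<Rightarrow> 'x \<Rightarrow> 'h" where
  "section_at fn k x = inv fn (k x)"

definition rkhs ::
  "('h::{real_inner, complete_space} \<Rightarrow> 'x \<Rightarrow> real) \<Rightarrow> ('x \<Rightarrow> 'x \<Rightarrow> real) \<Rightarrow> bool" where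
  "rkhs fn k \<longleftrightarrow>
     (\<forall>x. linear (\<lambda>g. fn g x)) \<and> inj fn \<and>
     (\<forall>x. k x \<in> range fn) \<and>
     (\<forall>g x. fn g x = inner g (section_at fn k x))"

definition measure_support :: "'x::topological_space measure \<Rightarrow> 'x set" where
  "measure_support \<mu> = {x. \<forall>U. open U \<and> x \<in> U \<longrightarrow> emeasure \<mu> U > 0}"

text \<open>
  The label space is \<open>count_space {-1, 1}\<close> with real labels. \<open>\<kappa> x\<close> is the conditional
  distribution of the label given \<open>x\<close>.
\<close>

definition marginal :: "'x measure \<Rightarrow> ('x \<times> real) measure \<Rightarrow> 'x measure" where
  "marginal \<X> \<rho> = distr \<rho> \<X> fst"

definition conditional_distribution ::
  "'x measure \<Rightarrow> ('x \<times> real) measure \<Rightarrow> ('x \<Rightarrow> real measure) \<Rightarrow> bool" where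
  "conditional_distribution \<X> \<rho> \<kappa> \<longleftrightarrow>
     \<kappa> \<in> measurable \<X> (prob_algebra (count_space {-1, 1})) \<and>
     (\<forall>A\<in>sets \<X>. \<forall>B\<subseteq>{-1, 1}.
        emeasure \<rho> (A \<times> B) = (\<integral>\<^sup>+ x\<in>A. emeasure (\<kappa> x) B \<partial>marginal \<X> \<rho>))"

definition cond_mean :: "('x \<Rightarrow> real measure) \<Rightarrow> 'x \<Rightarrow> real" where
  "cond_mean \<kappa> x = (LINT y|\<kappa> x. y)"

definition loss :: "(real \<Rightarrow> real) \<Rightarrow> real \<Rightarrow> real \<Rightarrow> real" where
  "loss \<phi> \<zeta> y = \<phi> (y * \<zeta>)"

definition dloss :: "(real \<Rightarrow> real) \<Rightarrow> real \<Rightarrow> real \<Rightarrow> real" where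
  "dloss \<phi> \<zeta> y = deriv (\<lambda>u. loss \<phi> u y) \<zeta>"

text \<open>
  The risk takes values in \<open>[0, \<infinity>]\<close>: a Bayes rule competes with all measurable functions,
  including those of infinite risk, for which the Bochner integral would be \<open>0\<close>.
\<close>

definition risk :: "('x \<times> real) measure \<Rightarrow> (real \<Rightarrow> real) \<Rightarrow> ('x \<Rightarrow> real) \<Rightarrow> ennreal" where
  "risk \<rho> \<phi> g = (\<integral>\<^sup>+ z. ennreal (loss \<phi> (g (fst z)) (snd z)) \<partial>\<rho>)"

definition bayes_rule ::
  "'x measure \<Rightarrow> ('x \<times> real) measure \<Rightarrow> (real \<Rightarrow> real) \<Rightarrow> ('x \<Rightarrow> real) \<Rightarrow> bool" where
  "bayes_rule \<X> \<rho> \<phi> g \<longleftrightarrow>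
     g \<in> borel_measurable \<X> \<and> (\<forall>f\<in>borel_measurable \<X>. risk \<rho> \<phi> g \<le> risk \<rho> \<phi> f)"

definition rkhs_risk ::
  "('h \<Rightarrow> 'x \<Rightarrow> real) \<Rightarrow> ('x \<times> real) measure \<Rightarrow> (real \<Rightarrow> real) \<Rightarrow> 'h \<Rightarrow> real" where
  "rkhs_risk fn \<rho> \<phi> g = enn2real (risk \<rho> \<phi> (fn g))"

definition reg_risk ::
  "('h::real_inner \<Rightarrow> 'x \<Rightarrow> real) \<Rightarrow> ('x \<times> real) measure \<Rightarrow> (real \<Rightarrow> real) \<Rightarrow> real \<Rightarrow> 'h \<Rightarrow> real" where
  "reg_risk fn \<rho> \<phi> lam g = rkhs_risk fn \<rho> \<phi> g + lam / 2 * (norm g)\<^sup>2"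

definition reg_minimizer ::
  "('h::real_inner \<Rightarrow> 'x \<Rightarrow> real) \<Rightarrow> ('x \<times> real) measure \<Rightarrow> (real \<Rightarrow> real) \<Rightarrow> real \<Rightarrow> 'h" where
  "reg_minimizer fn \<rho> \<phi> lam = (ARG_MIN (reg_risk fn \<rho> \<phi> lam) g. True)"

definition smooth_with :: "('h::real_inner \<Rightarrow> real) \<Rightarrow> real \<Rightarrow> bool" where
  "smooth_with F L \<longleftrightarrow>
     (\<forall>g. \<exists>D. (GDERIV F g :> D) \<and>
        (\<forall>h. \<bar>F (g + h) - F g - inner D h\<bar> \<le> L / 2 * (norm h)\<^sup>2))"

text \<open>
  \<open>sgn 0 = 0\<close> here, so a predictor errs at every point where it vanishes.
\<close>

definition zero_one :: "real \<Rightarrow> real \<Rightarrow> real" where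
  "zero_one y y' = (if y \<noteq> y' then 1 else 0)"

definition class_error :: "('x \<times> real) measure \<Rightarrow> ('x \<Rightarrow> real) \<Rightarrow> real" where
  "class_error \<rho> g = (LINT z|\<rho>. zero_one (sgn (g (fst z))) (snd z))"

definition pointwise_risk :: "(real \<Rightarrow> real) \<Rightarrow> real \<Rightarrow> real \<Rightarrow> real" where
  "pointwise_risk \<phi> \<mu> h = \<mu> * \<phi> h + (1 - \<mu>) * \<phi> (- h)"

definition link :: "(real \<Rightarrow> real) \<Rightarrow> real \<Rightarrow> real" where
  "link \<phi> \<mu> = (ARG_MIN (pointwise_risk \<phi> \<mu>) h. True)"

definition link_well_defined :: "(real \<Rightarrow> real) \<Rightarrow> bool" where
  "link_well_defined \<phi> \<longleftrightarrow>
     (\<forall>\<mu>\<in>{0<..<1}. \<exists>!h. is_arg_min (pointwise_risk \<phi> \<mu>) (\<lambda>_. True) h)"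

definition min_risk :: "(real \<Rightarrow> real) \<Rightarrow> real \<Rightarrow> real" where
  "min_risk \<phi> \<mu> = (INF h. pointwise_risk \<phi> \<mu> h)"

definition bregman :: "(real \<Rightarrow> real) \<Rightarrow> real \<Rightarrow> real \<Rightarrow> real" where
  "bregman f \<eta>1 \<eta>2 = - f \<eta>2 + f \<eta>1 + deriv f \<eta>1 * (\<eta>2 - \<eta>1)"

definition margin :: "(real \<Rightarrow> real) \<Rightarrow> real \<Rightarrow> real" where
  "margin \<phi> \<delta> = min (link \<phi> (1/2 + \<delta>)) \<bar>link \<phi> (1/2 - \<delta>)\<bar>"

definition stoch_grad ::
  "('h::real_inner \<Rightarrow> 'x \<Rightarrow> real) \<Rightarrow> ('x \<Rightarrow> 'x \<Rightarrow> real) \<Rightarrow> (real \<Rightarrow> real) \<Rightarrow> real \<Rightarrow>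
   'h \<Rightarrow> 'x \<times> real \<Rightarrow> 'h" where
  "stoch_grad fn k \<phi> lam g z =
     dloss \<phi> (fn g (fst z)) (snd z) *\<^sub>R section_at fn k (fst z) + lam *\<^sub>R g"

definition step_size :: "real \<Rightarrow> real \<Rightarrow> nat \<Rightarrow> real" where
  "step_size lam \<gamma> t = 2 / (lam * (\<gamma> + real t))"

definition avg_weight :: "real \<Rightarrow> nat \<Rightarrow> nat \<Rightarrow> real" where
  "avg_weight \<gamma> T t = 2 * (\<gamma> + real t - 1) / ((2 * \<gamma> + real T) * (real T + 1))"

text \<open>Iterates are indexed from \<open>1\<close>; the value at index \<open>0\<close> is a dummy.\<close>

primrec sgd ::
  "('h::real_inner \<Rightarrow> 'x \<Rightarrow> real) \<Rightarrow> ('x \<Rightarrow> 'x \<Rightarrow> real) \<Rightarrow> (real \<Rightarrow> real) \<Rightarrow> real \<Rightarrow> real \<Rightarrow>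
   'h \<Rightarrow> (nat \<Rightarrow> 'x \<times> real) \<Rightarrow> nat \<Rightarrow> 'h" where
  "sgd fn k \<phi> lam \<gamma> g1 z 0 = g1"
| "sgd fn k \<phi> lam \<gamma> g1 z (Suc t) =
     (if t = 0 then g1
      else sgd fn k \<phi> lam \<gamma> g1 z t
             - step_size lam \<gamma> t *\<^sub>R stoch_grad fn k \<phi> lam (sgd fn k \<phi> lam \<gamma> g1 z t) (z t))"

definition avg_sgd ::
  "('h::real_inner \<Rightarrow> 'x \<Rightarrow> real) \<Rightarrow> ('x \<Rightarrow> 'x \<Rightarrow> real) \<Rightarrow> (real \<Rightarrow> real) \<Rightarrow> real \<Rightarrow> real \<Rightarrow>
   'h \<Rightarrow> nat \<Rightarrow> (nat \<Rightarrow> 'x \<times> real) \<Rightarrow> 'h" where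
  "avg_sgd fn k \<phi> lam \<gamma> g1 T z =
     (\<Sum>t = 1..T + 1. avg_weight \<gamma> T t *\<^sub>R sgd fn k \<phi> lam \<gamma> g1 z t)"

end

theory Submission
  imports Defs
begin

text \<open>
  As \<open>\<lambda> \<rightarrow> 0\<close>, the minimizers \<open>g\<^sub>\<lambda>\<close> converge in norm to a Bayes rule in the Hilbert space, because
  \<open>\<parallel>g\<^sub>\<lambda> - g\<^sub>\<mu>\<parallel>\<^sup>2 \<le> \<parallel>g\<^sub>\<lambda>\<parallel>\<^sup>2 - \<parallel>g\<^sub>\<mu>\<parallel>\<^sup>2\<close> for \<open>\<lambda> < \<mu>\<close>. By uniqueness this Bayes rule is \<open>h\<^sub>*(\<rho>(1|x))\<close>, whose modulus
  is at least \<open>m(\<delta>)\<close>; hence for small \<open>\<lambda>\<close> every \<open>g\<close> with \<open>\<parallel>g - g\<^sub>\<lambda>\<parallel> < m(\<delta>)/(2R)\<close> classifies optimally.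

  The deviation \<open>a\<^sub>t = \<parallel>g\<^sub>t - g\<^sub>\<lambda>\<parallel>\<^sup>2\<close> is controlled through \<open>E exp(\<beta>\<^sub>t a\<^sub>t)\<close> with
  \<open>\<beta>\<^sub>t = \<lambda>\<^sup>2(\<gamma> + t - 1)/(8M\<^sup>2R\<^sup>2)\<close>. Convexity of the loss gives the drift
  \<open>E\<langle>G\<^sub>\<lambda>(g, z), g - g\<^sub>\<lambda>\<rangle> \<ge> \<lambda>\<parallel>g - g\<^sub>\<lambda>\<parallel>\<^sup>2\<close>, and Hoeffding's lemma bounds the fluctuation of this inner product by
  a multiple of \<open>a\<^sub>t\<close> itself, which the drift absorbs. Thus \<open>log E exp(\<beta>\<^sub>t a\<^sub>t)\<close> satisfies a contracting
  recursion. Averaging over \<open>t\<close> by convexity of the exponential function and of \<open>\<parallel>\<cdot>\<parallel>\<^sup>2\<close>, and then Markov's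
  inequality, give the tail bound for the averaged iterate; no vector-valued martingale inequality is needed.
\<close>

section \<open>Strongly convex functions on a Hilbert space\<close>

text \<open>Midpoint strong convexity forces near-minimizers to be close to each other, so a
  minimizing sequence is Cauchy and completeness supplies the limit; no weak compactness is used.
  The set \<open>C\<close> makes room for two uses: orthogonal projection and the regularized
  risk.\<close>

lemma strongly_convex_attains_min:
  fixes F :: "'h::{real_inner, complete_space} \<Rightarrow> real"
  assumes "closed C" "C \<noteq> {}" "continuous_on C F" "bdd_below (F ` C)" "c > 0"
    and mid: "\<And>u v. u \<in> C \<Longrightarrow> v \<in> C \<Longrightarrow> (1/2) *\<^sub>R (u + v) \<in> C"
    and conv: "\<And>u v. u \<in> C \<Longrightarrow> v \<in> C \<Longrightarrow>
      F ((1/2) *\<^sub>R (u + v)) \<le> (F u + F v) / 2 - c * (norm (u - v))\<^sup>2"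
  obtains u where "u \<in> C" "\<And>v. v \<in> C \<Longrightarrow> F u \<le> F v"
proof -
  define I where "I = (INF v\<in>C. F v)"
  have I: "I \<le> F v" if "v \<in> C" for v
    unfolding I_def using assms(4) that by (rule cINF_lower)
  have "\<exists>v\<in>C. F v < I + inverse (real (Suc n))" for n
    using cINF_less_iff[OF assms(2,4), of "I + inverse (real (Suc n))"] unfolding I_def[symmetric]
    by auto
  then obtain x where x: "\<And>n. x n \<in> C" "\<And>n. F (x n) < I + inverse (real (Suc n))"
    by metis
  have "Cauchy x"
  proof (rule metric_CauchyI)
    fix e :: real assume "e > 0"
    then have "c * e\<^sup>2 > 0" using \<open>c > 0\<close> by simp
    then obtain N where N: "inverse (real (Suc N)) < c * e\<^sup>2"
      using reals_Archimedean by blast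
    have "dist (x m) (x n) < e" if "m \<ge> N" "n \<ge> N" for m n
    proof -
      have inv: "inverse (real (Suc j)) \<le> inverse (real (Suc N))" if "j \<ge> N" for j
        using that by (auto intro!: le_imp_inverse_le)
      \<comment> \<open>The midpoint still has value at least \<open>I\<close>, so two points with
        values within \<open>c * e\<^sup>2\<close> of \<open>I\<close> are at distance below
        \<open>e\<close>.\<close>
      have "I \<le> (F (x m) + F (x n)) / 2 - c * (norm (x m - x n))\<^sup>2"
        using I[OF mid[OF x(1) x(1)]] conv[OF x(1) x(1)] by (rule order_trans)
      then have "c * (norm (x m - x n))\<^sup>2 < c * e\<^sup>2"
        using x(2)[of m] x(2)[of n] inv[OF \<open>m \<ge> N\<close>] inv[OF \<open>n \<ge> N\<close>] N by argo
      then have "(norm (x m - x n))\<^sup>2 < e\<^sup>2" using \<open>c > 0\<close> by simp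
      then show ?thesis
        using \<open>e > 0\<close> by (simp add: dist_norm power2_less_imp_less)
    qed
    then show "\<exists>N. \<forall>m\<ge>N. \<forall>n\<ge>N. dist (x m) (x n) < e" by blast
  qed
  then obtain u where u: "x \<longlonglongrightarrow> u"
    using Cauchy_convergent convergent_def by blast
  have uC: "u \<in> C" using closed_sequentially[OF \<open>closed C\<close>] x(1) u by blast
  have "(\<lambda>n. F (x n)) \<longlonglongrightarrow> F u"
    using continuous_on_tendsto_compose[OF assms(3) u uC] x(1) by simp
  moreover have "(\<lambda>n. I + inverse (real (Suc n))) \<longlonglongrightarrow> I + 0"
    by (intro tendsto_add tendsto_const LIMSEQ_inverse_real_of_nat)
  ultimately have "F u \<le> I + 0"
    by (rule LIMSEQ_le) (use x(2) less_imp_le in blast)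
  with uC I that show ?thesis by fastforce
qed

text \<open>Minimality at a point of the segment cancels \<open>F u\<close>; dividing by
  \<open>s\<close> leaves the factor \<open>1 - s\<close>, which tends to 1 and yields the full
  constant \<open>c\<close>.\<close>

lemma strongly_convex_growth:
  fixes F :: "'h::real_normed_vector \<Rightarrow> real"
  assumes conv: "\<And>s. 0 < s \<Longrightarrow> s < 1 \<Longrightarrow>
      F ((1 - s) *\<^sub>R u + s *\<^sub>R v) \<le> (1 - s) * F u + s * F v - c * s * (1 - s) * (norm (v - u))\<^sup>2"
    and min: "\<And>w. F u \<le> F w"
  shows "F u + c * (norm (v - u))\<^sup>2 \<le> F v"
proof -
  have *: "c * (1 - s) * (norm (v - u))\<^sup>2 \<le> F v - F u" if "0 < s" "s < 1" for s
  proof -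
    have "s * (c * (1 - s) * (norm (v - u))\<^sup>2) \<le> s * (F v - F u)"
      using conv[OF that] min[of "(1 - s) *\<^sub>R u + s *\<^sub>R v"] by (simp add: algebra_simps)
    then show ?thesis using that by simp
  qed
  have "((\<lambda>s. c * (1 - s) * (norm (v - u))\<^sup>2) \<longlongrightarrow> c * (1 - 0) * (norm (v - u))\<^sup>2) (at_right 0)"
    by (intro tendsto_intros)
  moreover have "\<forall>\<^sub>F s in at_right 0. c * (1 - s) * (norm (v - u))\<^sup>2 \<le> F v - F u"
    using eventually_at_right_less[of 0] eventually_at_right_real[of 0 1]
    by (rule eventually_elim2) (use * in auto)
  ultimately have "c * (1 - 0) * (norm (v - u))\<^sup>2 \<le> F v - F u"
    by (intro tendsto_upperbound) auto
  then show ?thesis by simp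
qed

text \<open>An exact form of strong convexity of the squared norm; all strong convexity below comes
  from this identity.\<close>

lemma norm_sq_convex_comb:
  fixes u v :: "'h::real_inner"
  shows "(norm ((1 - s) *\<^sub>R u + s *\<^sub>R v))\<^sup>2 =
    (1 - s) * (norm u)\<^sup>2 + s * (norm v)\<^sup>2 - s * (1 - s) * (norm (v - u))\<^sup>2"
proof -
  have 1: "inner ((1 - s) *\<^sub>R u + s *\<^sub>R v) ((1 - s) *\<^sub>R u + s *\<^sub>R v) =
    (1 - s) * (1 - s) * inner u u + 2 * s * (1 - s) * inner u v + s * s * inner v v"
    by (simp add: inner_add_left inner_add_right inner_commute[of v u] distrib_left mult.assoc mult.left_commute)
  have 2: "inner (v - u) (v - u) = inner v v - 2 * inner u v + inner u u"
    by (simp add: inner_diff_left inner_diff_right inner_commute[of v u])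
  show ?thesis unfolding power2_norm_eq_inner 1 2 by (simp add: left_diff_distrib right_diff_distrib distrib_left distrib_right)
qed
lemma norm_sq_diff_scaleR:
  fixes w v :: "'h::real_inner"
  shows "(norm (w - s *\<^sub>R v))\<^sup>2 = (norm w)\<^sup>2 - 2 * s * inner w v + s\<^sup>2 * (norm v)\<^sup>2"
proof -
  have "inner (w - s *\<^sub>R v) (w - s *\<^sub>R v) = inner w w - 2 * s * inner w v + s * s * inner v v"
    by (simp add: inner_diff_left inner_diff_right inner_commute[of v w] right_diff_distrib)
  then show ?thesis by (simp add: power2_norm_eq_inner power2_eq_square[of s])
qed

text \<open>The distance from \<open>g\<close> to \<open>V\<close> is attained at some
  \<open>p\<close>, and optimality makes \<open>g - p\<close> orthogonal to \<open>V\<close>, hence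
  0. The criterion serves to extend a property from kernel sections to the whole space.\<close>

lemma closed_subspace_eq_UNIV:
  fixes V :: "'h::{real_inner, complete_space} set"
  assumes V: "subspace V" "closed V" and orth: "\<And>g. (\<And>v. v \<in> V \<Longrightarrow> inner g v = 0) \<Longrightarrow> g = 0"
  shows "V = UNIV"
proof -
  have "g \<in> V" for g
  proof -
    obtain p where p: "p \<in> V" "\<And>v. v \<in> V \<Longrightarrow> (norm (g - p))\<^sup>2 \<le> (norm (g - v))\<^sup>2"
    proof (rule strongly_convex_attains_min[of V "\<lambda>v. (norm (g - v))\<^sup>2" "1/4"])
      show "V \<noteq> {}" using subspace_0[OF V(1)] by auto
      show "continuous_on V (\<lambda>v. (norm (g - v))\<^sup>2)" by (intro continuous_intros)
      show "(1/2) *\<^sub>R (u + v) \<in> V" if "u \<in> V" "v \<in> V" for u v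
        using that V(1) by (simp add: subspace_add subspace_scale)
      show "(norm (g - (1/2) *\<^sub>R (u + v)))\<^sup>2 \<le>
          ((norm (g - u))\<^sup>2 + (norm (g - v))\<^sup>2) / 2 - 1/4 * (norm (u - v))\<^sup>2" for u v
      proof -
        have "g - (1/2) *\<^sub>R (u + v) = (1 - 1/2) *\<^sub>R (g - u) + (1/2) *\<^sub>R (g - v)"
          by (simp add: algebra_simps flip: scaleR_add_left)
        then show ?thesis
          unfolding norm_sq_convex_comb[symmetric]
          using norm_sq_convex_comb[of "1/2" "g - u" "g - v"]
          by (simp add: norm_minus_commute power2_eq_square field_simps)
      qed
      show "bdd_below ((\<lambda>v. (norm (g - v))\<^sup>2) ` V)"
        by (intro bdd_belowI2[of _ 0]) simp
    qed (use V in auto)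
    have "g - p = 0"
    proof (rule orth)
      fix v assume v: "v \<in> V"
      have *: "(norm (g - p))\<^sup>2 \<le> (norm (g - (p + s *\<^sub>R v)))\<^sup>2" for s
        using V(1) p(1) v by (intro p(2)) (simp add: subspace_add subspace_scale)
      define a where "a = inner (g - p) v"
      have q: "2 * s * a \<le> s\<^sup>2 * (norm v)\<^sup>2" for s
        using *[of s] norm_sq_diff_scaleR[of "g - p" s v] unfolding a_def diff_diff_eq by linarith
      show "inner (g - p) v = 0"
      proof (cases "v = 0")
        case False
        then have n: "(norm v)\<^sup>2 > 0" by simp
        \<comment> \<open>\<open>s = a / (norm v)\<^sup>2\<close> maximizes the gain
          \<open>2 * s * a - s\<^sup>2 * (norm v)\<^sup>2\<close> in squared distance, which cannot
          be positive.\<close>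
        have "(a / (norm v)\<^sup>2)\<^sup>2 * (norm v)\<^sup>2 = a / (norm v)\<^sup>2 * a"
          using n by (simp add: power2_eq_square)
        with q[of "a / (norm v)\<^sup>2"] have "a\<^sup>2 / (norm v)\<^sup>2 \<le> 0"
          by (simp add: power2_eq_square)
        with n have "a\<^sup>2 \<le> 0" by (simp add: divide_le_0_iff)
        then show ?thesis by (simp add: a_def)
      qed simp
    qed
    with p(1) show ?thesis by simp
  qed
  then show ?thesis by blast
qed

section \<open>Convex functions of one real variable\<close>

lemma convex_above_tangent:
  fixes \<phi> :: "real \<Rightarrow> real"
  assumes "convex_on UNIV \<phi>" "\<phi> differentiable (at a)"
  shows "\<phi> a + deriv \<phi> a * (b - a) \<le> \<phi> b"
proof -
  have "deriv \<phi> a * (b - a) \<le> \<phi> b - \<phi> a"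
    using convex_on_imp_above_tangent[OF assms(1), of a b "deriv \<phi> a"] assms(2)
    by (simp add: DERIV_deriv_iff_real_differentiable)
  then show ?thesis by simp
qed

text \<open>The tangent inequalities at \<open>a\<close> and at \<open>b\<close> are added.
  Monotonicity is what makes \<open>deriv \<phi>\<close> Borel measurable, as its continuity is not
  assumed.\<close>

lemma deriv_convex_mono:
  fixes \<phi> :: "real \<Rightarrow> real"
  assumes "convex_on UNIV \<phi>" "\<And>u. \<phi> differentiable (at u)"
  shows "mono (deriv \<phi>)"
proof (rule monoI)
  fix a b :: real assume "a \<le> b"
  show "deriv \<phi> a \<le> deriv \<phi> b"
  proof (cases "a = b")
    case False
    with \<open>a \<le> b\<close> have "a < b" by simp
    moreover have "deriv \<phi> a * (b - a) \<le> deriv \<phi> b * (b - a)"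
      using convex_above_tangent[OF assms, of a b] convex_above_tangent[OF assms, of b a]
      by (simp add: algebra_simps)
    ultimately show ?thesis by simp
  qed simp
qed

section \<open>Risks over a reproducing kernel Hilbert space\<close>

locale kernel_learning = prob_space \<rho>
  for \<rho> :: "('x \<times> real) measure" +
  fixes \<X> :: "'x measure"
    and fn :: "'h::{real_inner, complete_space} \<Rightarrow> 'x \<Rightarrow> real"
    and k :: "'x \<Rightarrow> 'x \<Rightarrow> real"
    and \<phi> :: "real \<Rightarrow> real"
    and M R :: real
  assumes space_X: "space \<X> = UNIV"
    and sets_rho [measurable_cong]: "sets \<rho> = sets (\<X> \<Otimes>\<^sub>M count_space {-1, 1})"
    and rkhs: "rkhs fn k"
    and k_measurable': "case_prod k \<in> borel_measurable (\<X> \<Otimes>\<^sub>M \<X>)"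
    and phi_nonneg: "\<And>u. \<phi> u \<ge> 0"
    and phi_convex: "convex_on UNIV \<phi>"
    and phi_diff: "\<And>u. \<phi> differentiable (at u)"
    and M_pos: "M > 0"
    and dloss_bound: "\<And>\<zeta> y. y \<in> {-1, 1} \<Longrightarrow> \<bar>dloss \<phi> \<zeta> y\<bar> \<le> M"
    and R_pos: "R > 0"
    and k_bound: "\<And>x. k x x \<le> R\<^sup>2"
begin

section \<open>Evaluation functionals and measurability of the functions in the space\<close>

abbreviation K :: "'x \<Rightarrow> 'h" where "K x \<equiv> section_at fn k x"

lemma fn_eq: "fn g x = inner g (K x)"
  using rkhs unfolding rkhs_def by blast

lemma fn_K: "fn (K x) = k x"
  using rkhs unfolding rkhs_def section_at_def by (simp add: f_inv_into_f)

lemma inner_K_K: "inner (K x) (K y) = k x y"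
  by (simp add: fn_K flip: fn_eq)

lemma norm_K: "norm (K x) \<le> R"
proof -
  have "(norm (K x))\<^sup>2 \<le> R\<^sup>2" using k_bound[of x] by (simp add: power2_norm_eq_inner inner_K_K)
  then show ?thesis using R_pos by (simp add: power2_le_iff_abs_le)
qed

lemma fn_bound: "\<bar>fn g x\<bar> \<le> R * norm g"
proof -
  have "\<bar>fn g x\<bar> \<le> norm g * norm (K x)"
    using Cauchy_Schwarz_ineq2[of g "K x"] by (simp add: fn_eq)
  also have "\<dots> \<le> norm g * R" by (intro mult_left_mono norm_K) auto
  finally show ?thesis by (simp add: mult.commute)
qed

lemma fn_diff: "fn (g - h) x = fn g x - fn h x"
  and fn_add: "fn (g + h) x = fn g x + fn h x"
  and fn_scaleR: "fn (c *\<^sub>R g) x = c * fn g x"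
  by (simp_all add: fn_eq inner_diff_left inner_add_left)

lemma fn_eq_0_iff: "(\<forall>x. fn g x = 0) \<longleftrightarrow> g = 0"
proof
  assume "\<forall>x. fn g x = 0"
  then have "fn g = fn 0" by (auto simp: fun_eq_iff fn_eq[of 0])
  then show "g = 0" using rkhs unfolding rkhs_def by (auto dest: injD)
qed (simp add: fn_eq)

lemma k_measurable [measurable (raw)]:
  assumes "f \<in> measurable N \<X>" "g \<in> measurable N \<X>"
  shows "(\<lambda>w. k (f w) (g w)) \<in> borel_measurable N"
  using measurable_compose[OF measurable_Pair[OF assms] k_measurable'] by simp

text \<open>The \<open>g\<close> with measurable \<open>fn g\<close> form a subspace that contains
  every kernel section; it is closed because norm convergence implies pointwise convergence. An
  element orthogonal to all sections vanishes everywhere.\<close>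

lemma fn_measurable [measurable]: "fn g \<in> borel_measurable \<X>"
proof -
  define V where "V = {g. fn g \<in> borel_measurable \<X>}"
  have "V = UNIV"
  proof (rule closed_subspace_eq_UNIV)
    have lin: "fn (g + h) = (\<lambda>x. fn g x + fn h x)" "fn (c *\<^sub>R g) = (\<lambda>x. c * fn g x)"
        "fn 0 = (\<lambda>x. 0)" for g h c
      by (auto simp: fn_add fn_scaleR fn_eq[of 0])
    show "subspace V"
      unfolding subspace_def V_def by (auto simp: lin)
    show "closed V"
      unfolding closed_sequential_limits
    proof (intro allI impI, elim conjE)
      fix u :: "nat \<Rightarrow> 'h" and l assume u: "\<forall>n. u n \<in> V" "u \<longlonglongrightarrow> l"
      have "(\<lambda>n. fn (u n) x) \<longlonglongrightarrow> fn l x" for x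
        using tendsto_inner[OF u(2) tendsto_const] by (simp add: fn_eq)
      then show "l \<in> V"
        using u(1) borel_measurable_LIMSEQ_real[of \<X> "\<lambda>n. fn (u n)" "fn l"]
        unfolding V_def by blast
    qed
    fix g assume g: "\<And>v. v \<in> V \<Longrightarrow> inner g v = 0"
    have "K x \<in> V" for x
    proof -
      have [measurable]: "(\<lambda>_. x) \<in> measurable \<X> \<X>" by (simp add: space_X)
      have "(\<lambda>y. k x y) \<in> borel_measurable \<X>" by measurable
      then show ?thesis by (simp add: V_def fn_K)
    qed
    then have "fn g x = 0" for x using g by (simp add: fn_eq)
    then show "g = 0" using fn_eq_0_iff by blast
  qed
  then show ?thesis unfolding V_def by blast
qed

section \<open>The loss and its derivative\<close>

lemma phi_has_deriv: "(\<phi> has_real_derivative deriv \<phi> u) (at u)"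
  using phi_diff by (simp add: DERIV_deriv_iff_real_differentiable)

lemma dloss_eq: "dloss \<phi> \<zeta> y = y * deriv \<phi> (y * \<zeta>)"
proof -
  have "((\<lambda>u. \<phi> (y * u)) has_real_derivative deriv \<phi> (y * \<zeta>) * y) (at \<zeta>)"
    by (rule DERIV_chain2[OF phi_has_deriv]) (auto intro!: derivative_eq_intros)
  then show ?thesis unfolding dloss_def loss_def by (simp add: DERIV_imp_deriv mult.commute)
qed

lemma phi_measurable [measurable]: "\<phi> \<in> borel_measurable borel"
  by (intro borel_measurable_continuous_onI continuous_at_imp_continuous_on)
     (use phi_has_deriv DERIV_isCont in blast)

lemma dloss_measurable [measurable (raw)]:
  assumes [measurable]: "f \<in> borel_measurable N" "g \<in> borel_measurable N"
  shows "(\<lambda>w. dloss \<phi> (f w) (g w)) \<in> borel_measurable N"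
proof -
  have [measurable]: "deriv \<phi> \<in> borel_measurable borel"
    by (intro borel_measurable_mono deriv_convex_mono phi_convex phi_diff)
  show ?thesis unfolding dloss_eq by measurable
qed

lemma fst_rho [measurable]: "fst \<in> measurable \<rho> \<X>"
  by (simp add: measurable_cong_sets[OF sets_rho refl])

lemma snd_rho [measurable]: "snd \<in> borel_measurable \<rho>"
proof -
  have "snd \<in> measurable \<rho> (count_space {-1, 1})"
    by (simp add: measurable_cong_sets[OF sets_rho refl])
  then show ?thesis
    by (rule measurable_compose) simp
qed

lemma snd_in: "z \<in> space \<rho> \<Longrightarrow> snd z \<in> {-1, 1}"
  unfolding sets_eq_imp_space_eq[OF sets_rho] space_pair_measure space_count_space
  by (rule mem_Times_iff[THEN iffD1, THEN conjunct2])

lemma loss_tangent: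
  "loss \<phi> a y + dloss \<phi> a y * (b - a) \<le> loss \<phi> b y"
  using convex_above_tangent[OF phi_convex phi_diff, of "y * a" "y * b"]
  unfolding loss_def dloss_eq by (simp add: algebra_simps)

lemma loss_lipschitz:
  assumes "y \<in> {-1, 1}" shows "\<bar>loss \<phi> a y - loss \<phi> b y\<bar> \<le> M * \<bar>a - b\<bar>"
proof -
  have "\<bar>dloss \<phi> c y * d\<bar> \<le> M * \<bar>d\<bar>" for c d
    using dloss_bound[OF assms, of c] by (simp add: abs_mult mult_right_mono)
  from this[of a "b - a"] this[of b "a - b"] show ?thesis
    using loss_tangent[of a y b] loss_tangent[of b y a] by (simp add: abs_minus_commute abs_le_iff)
qed

lemma loss_convex_comb:
  assumes "0 \<le> s" "s \<le> 1"
  shows "loss \<phi> ((1 - s) * a + s * b) y \<le> (1 - s) * loss \<phi> a y + s * loss \<phi> b y"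
  using convex_onD[OF phi_convex assms, of "y * a" "y * b"]
  unfolding loss_def by (simp add: algebra_simps)

lemma loss_integrable: "integrable \<rho> (\<lambda>z. loss \<phi> (fn g (fst z)) (snd z))"
proof (rule integrable_const_bound)
  \<comment> \<open>The loss at prediction 0 equals \<open>\<phi> 0\<close> for either label; the
    Lipschitz bound in the prediction adds the rest.\<close>
  show "AE z in \<rho>. norm (loss \<phi> (fn g (fst z)) (snd z)) \<le> \<phi> 0 + M * (R * norm g)"
  proof (rule AE_I2)
    fix z assume z: "z \<in> space \<rho>"
    have "\<bar>loss \<phi> (fn g (fst z)) (snd z) - loss \<phi> 0 (snd z)\<bar> \<le> M * \<bar>fn g (fst z) - 0\<bar>"
      by (rule loss_lipschitz[OF snd_in[OF z]])
    also have "\<dots> \<le> M * (R * norm g)"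
      using fn_bound M_pos by (auto intro!: mult_left_mono)
    finally show "norm (loss \<phi> (fn g (fst z)) (snd z)) \<le> \<phi> 0 + M * (R * norm g)"
      by (simp add: loss_def phi_nonneg)
  qed
  show "(\<lambda>z. loss \<phi> (fn g (fst z)) (snd z)) \<in> borel_measurable \<rho>"
    unfolding loss_def by measurable
qed

section \<open>Continuity and convexity of the risk\<close>

lemma rkhs_risk_eq: "rkhs_risk fn \<rho> \<phi> g = (LINT z|\<rho>. loss \<phi> (fn g (fst z)) (snd z))"
  unfolding rkhs_risk_def risk_def
  by (subst nn_integral_eq_integral[OF loss_integrable])
     (auto simp: loss_def phi_nonneg)

text \<open>Elements of the space have finite risk, so real comparisons transfer to the
  extended-valued risk that defines Bayes rules.\<close>

lemma risk_eq_rkhs_risk: "risk \<rho> \<phi> (fn g) = ennreal (rkhs_risk fn \<rho> \<phi> g)"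
  unfolding rkhs_risk_eq risk_def
  by (subst nn_integral_eq_integral[OF loss_integrable]) (auto simp: loss_def phi_nonneg)

lemma rkhs_risk_nonneg: "rkhs_risk fn \<rho> \<phi> g \<ge> 0"
  by (simp add: rkhs_risk_def)

lemma rkhs_risk_lipschitz:
  "\<bar>rkhs_risk fn \<rho> \<phi> g - rkhs_risk fn \<rho> \<phi> h\<bar> \<le> M * R * norm (g - h)"
proof -
  let ?l = "\<lambda>g z. loss \<phi> (fn g (fst z)) (snd z)"
  have "\<bar>rkhs_risk fn \<rho> \<phi> g - rkhs_risk fn \<rho> \<phi> h\<bar> = \<bar>LINT z|\<rho>. ?l g z - ?l h z\<bar>"
    unfolding rkhs_risk_eq by (simp add: loss_integrable)
  also have "\<dots> \<le> (LINT z|\<rho>. \<bar>?l g z - ?l h z\<bar>)"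
    by (rule integral_abs_bound)
  also have "\<dots> \<le> (LINT z|\<rho>. M * R * norm (g - h))"
  proof (rule integral_mono)
    fix z assume z: "z \<in> space \<rho>"
    have "\<bar>?l g z - ?l h z\<bar> \<le> M * \<bar>fn g (fst z) - fn h (fst z)\<bar>"
      by (rule loss_lipschitz[OF snd_in[OF z]])
    also have "\<dots> \<le> M * (R * norm (g - h))"
      unfolding fn_diff[symmetric] using fn_bound M_pos by (auto intro!: mult_left_mono)
    finally show "\<bar>?l g z - ?l h z\<bar> \<le> M * R * norm (g - h)" by (simp add: mult.assoc)
  qed (auto simp: loss_integrable)
  finally show ?thesis by (simp add: prob_space)
qed

lemma rkhs_risk_tendsto:
  assumes "(g \<longlongrightarrow> l) F"
  shows "((\<lambda>n. rkhs_risk fn \<rho> \<phi> (g n)) \<longlongrightarrow> rkhs_risk fn \<rho> \<phi> l) F"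
proof (rule LIM_zero_cancel, rule Lim_null_comparison)
  show "\<forall>\<^sub>F n in F. norm (rkhs_risk fn \<rho> \<phi> (g n) - rkhs_risk fn \<rho> \<phi> l) \<le> M * R * norm (g n - l)"
    using rkhs_risk_lipschitz by simp
  have "((\<lambda>n. M * R * norm (g n - l)) \<longlongrightarrow> M * R * norm (l - l)) F"
    by (intro tendsto_intros assms)
  then show "((\<lambda>n. M * R * norm (g n - l)) \<longlongrightarrow> 0) F" by simp
qed

lemma rkhs_risk_convex:
  assumes "0 \<le> s" "s \<le> 1"
  shows "rkhs_risk fn \<rho> \<phi> ((1 - s) *\<^sub>R u + s *\<^sub>R v)
    \<le> (1 - s) * rkhs_risk fn \<rho> \<phi> u + s * rkhs_risk fn \<rho> \<phi> v"
proof -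
  let ?l = "\<lambda>g z. loss \<phi> (fn g (fst z)) (snd z)"
  have "rkhs_risk fn \<rho> \<phi> ((1 - s) *\<^sub>R u + s *\<^sub>R v) \<le> (LINT z|\<rho>. (1 - s) * ?l u z + s * ?l v z)"
    unfolding rkhs_risk_eq
  proof (rule integral_mono)
    fix z
    show "?l ((1 - s) *\<^sub>R u + s *\<^sub>R v) z \<le> (1 - s) * ?l u z + s * ?l v z"
      unfolding fn_add fn_scaleR by (rule loss_convex_comb[OF assms])
  qed (auto simp: loss_integrable)
  also have "\<dots> = (1 - s) * rkhs_risk fn \<rho> \<phi> u + s * rkhs_risk fn \<rho> \<phi> v"
    unfolding rkhs_risk_eq by (simp add: loss_integrable)
  finally show ?thesis .
qed

lemma reg_risk_convex:
  assumes "0 \<le> s" "s \<le> 1"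
  shows "reg_risk fn \<rho> \<phi> lam ((1 - s) *\<^sub>R u + s *\<^sub>R v)
    \<le> (1 - s) * reg_risk fn \<rho> \<phi> lam u + s * reg_risk fn \<rho> \<phi> lam v
      - lam / 2 * s * (1 - s) * (norm (v - u))\<^sup>2"
proof -
  have *: "lam / 2 * ((1 - s) * a + s * b - s * (1 - s) * c) =
      (1 - s) * (lam / 2 * a) + s * (lam / 2 * b) - lam / 2 * s * (1 - s) * c" for a b c :: real
    by (simp add: field_simps)
  show ?thesis
    using rkhs_risk_convex[OF assms, of u v]
    unfolding reg_risk_def norm_sq_convex_comb distrib_left * by linarith
qed

section \<open>The regularized minimizer\<close>

context
  fixes lam :: real
  assumes lam: "lam > 0"
begin

lemma reg_minimizer_le: "reg_risk fn \<rho> \<phi> lam (reg_minimizer fn \<rho> \<phi> lam) \<le> reg_risk fn \<rho> \<phi> lam g"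
proof -
  obtain u where "\<And>v. reg_risk fn \<rho> \<phi> lam u \<le> reg_risk fn \<rho> \<phi> lam v"
  \<comment> \<open>\<open>lam / 8\<close> is the modulus \<open>lam / 2\<close> times
    \<open>s * (1 - s)\<close> at \<open>s = 1/2\<close>.\<close>
  proof (rule strongly_convex_attains_min[of UNIV "reg_risk fn \<rho> \<phi> lam" "lam / 8"])
    show "continuous_on UNIV (reg_risk fn \<rho> \<phi> lam)"
      unfolding reg_risk_def continuous_on by (auto intro!: tendsto_intros rkhs_risk_tendsto)
    show "bdd_below (range (reg_risk fn \<rho> \<phi> lam))"
      using lam by (auto intro!: bdd_belowI[of _ 0] simp: reg_risk_def rkhs_risk_nonneg)
    show "reg_risk fn \<rho> \<phi> lam ((1/2) *\<^sub>R (u + v)) \<le>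
        (reg_risk fn \<rho> \<phi> lam u + reg_risk fn \<rho> \<phi> lam v) / 2 - lam / 8 * (norm (u - v))\<^sup>2" for u v
      using reg_risk_convex[of "1/2" lam u v]
      by (simp add: scaleR_add_right norm_minus_commute field_simps)
  qed (use lam in auto)
  \<comment> \<open>\<open>reg_minimizer\<close> is a choice operator: it meets its specification
    once a minimizer is known to exist.\<close>
  then have "\<exists>u. is_arg_min (reg_risk fn \<rho> \<phi> lam) (\<lambda>_. True) u"
    by (auto simp: is_arg_min_linorder)
  then have "is_arg_min (reg_risk fn \<rho> \<phi> lam) (\<lambda>_. True) (reg_minimizer fn \<rho> \<phi> lam)"
    unfolding reg_minimizer_def arg_min_def by (rule someI_ex)
  then show ?thesis by (simp add: is_arg_min_linorder)
qed

lemma reg_risk_growth: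
  "reg_risk fn \<rho> \<phi> lam (reg_minimizer fn \<rho> \<phi> lam) + lam / 2 * (norm (g - (reg_minimizer fn \<rho> \<phi> lam)))\<^sup>2 \<le> reg_risk fn \<rho> \<phi> lam g"
proof (rule strongly_convex_growth)
  show "reg_risk fn \<rho> \<phi> lam (reg_minimizer fn \<rho> \<phi> lam) \<le> reg_risk fn \<rho> \<phi> lam w" for w
    by (rule reg_minimizer_le)
  show "reg_risk fn \<rho> \<phi> lam ((1 - s) *\<^sub>R (reg_minimizer fn \<rho> \<phi> lam) + s *\<^sub>R g)
    \<le> (1 - s) * reg_risk fn \<rho> \<phi> lam (reg_minimizer fn \<rho> \<phi> lam) + s * reg_risk fn \<rho> \<phi> lam g
      - lam / 2 * s * (1 - s) * (norm (g - (reg_minimizer fn \<rho> \<phi> lam)))\<^sup>2" if "0 < s" "s < 1" for s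
    using that by (intro reg_risk_convex) auto
qed

end

end

section \<open>Vanishing regularization\<close>

context kernel_learning
begin

text \<open>Each minimizer is tested in the growth inequality of the other. In the sum the risks
  cancel, leaving \<open>(lam + lam') * d\<close> against \<open>lam' - lam\<close> times the
  difference of squared norms, and \<open>lam' - lam \<le> lam + lam'\<close>.\<close>

lemma reg_minimizer_dist:
  assumes "0 < lam" "lam < lam'"
  defines "G \<equiv> reg_minimizer fn \<rho> \<phi>"
  shows "(norm (G lam - G lam'))\<^sup>2 \<le> (norm (G lam))\<^sup>2 - (norm (G lam'))\<^sup>2"
proof -
  define d where "d = (norm (G lam - G lam'))\<^sup>2"
  have 1: "reg_risk fn \<rho> \<phi> lam (G lam) + lam / 2 * d \<le> reg_risk fn \<rho> \<phi> lam (G lam')"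
    using reg_risk_growth[OF \<open>0 < lam\<close>, of "G lam'"] by (simp add: d_def G_def norm_minus_commute)
  have 2: "reg_risk fn \<rho> \<phi> lam' (G lam') + lam' / 2 * d \<le> reg_risk fn \<rho> \<phi> lam' (G lam)"
    using reg_risk_growth[of lam' "G lam"] assms by (simp add: d_def G_def)
  have "(lam' - lam) * d \<le> (lam + lam') * d"
    using assms by (intro mult_right_mono) (auto simp: d_def)
  also have "\<dots> \<le> (lam' - lam) * ((norm (G lam))\<^sup>2 - (norm (G lam'))\<^sup>2)"
    using 1 2 unfolding reg_risk_def by (simp add: algebra_simps)
  finally show ?thesis using \<open>lam < lam'\<close> by (simp add: d_def)
qed

text \<open>A risk minimizer \<open>h\<close> can lose to the regularized minimizer only through the
  penalty.\<close>

lemma reg_minimizer_norm_le: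
  assumes "0 < lam" and min: "\<And>g. rkhs_risk fn \<rho> \<phi> h \<le> rkhs_risk fn \<rho> \<phi> g"
  shows "norm (reg_minimizer fn \<rho> \<phi> lam) \<le> norm h"
proof -
  have "lam / 2 * (norm (reg_minimizer fn \<rho> \<phi> lam))\<^sup>2 \<le> lam / 2 * (norm h)\<^sup>2"
    using reg_minimizer_le[OF \<open>0 < lam\<close>, of h] min[of "reg_minimizer fn \<rho> \<phi> lam"]
    unfolding reg_risk_def by linarith
  then show ?thesis using \<open>0 < lam\<close> by (simp add: power2_le_iff_abs_le)
qed

text \<open>Squared norms of the minimizers increase as \<lambda> decreases and are bounded by that
  of \<open>h\<close>, hence converge; the distance estimate turns this into norm convergence
  without compactness.\<close>

lemma reg_minimizer_tendsto:
  assumes min: "\<And>g. rkhs_risk fn \<rho> \<phi> h \<le> rkhs_risk fn \<rho> \<phi> g"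
  obtains g0 where "(reg_minimizer fn \<rho> \<phi> \<longlongrightarrow> g0) (at_right 0)"
    "\<And>g. rkhs_risk fn \<rho> \<phi> g0 \<le> rkhs_risk fn \<rho> \<phi> g"
proof -
  define G where "G = reg_minimizer fn \<rho> \<phi>"
  define l where "l = (\<lambda>n. inverse (real (Suc n)))"
  define a where "a = (\<lambda>n. (norm (G (l n)))\<^sup>2)"
  have l: "0 < l n" for n by (simp add: l_def)
  have dist: "(norm (G x - G y))\<^sup>2 \<le> (norm (G x))\<^sup>2 - (norm (G y))\<^sup>2" if "0 < x" "x \<le> y" for x y
    using reg_minimizer_dist[of x y] that unfolding G_def by (cases "x = y") auto
  have mono: "(norm (G y))\<^sup>2 \<le> (norm (G x))\<^sup>2" if "0 < x" "x \<le> y" for x y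
    using dist[OF that] zero_le_power2[of "norm (G x - G y)"] by linarith
  have "a n \<le> (norm h)\<^sup>2" for n
    unfolding a_def G_def using reg_minimizer_norm_le[OF l min] by (intro power_mono) auto
  moreover have "incseq a"
    unfolding a_def incseq_def using l by (intro allI impI mono) (auto simp: l_def)
  ultimately obtain s where s: "a \<longlonglongrightarrow> s" "\<And>n. a n \<le> s"
    using incseq_convergent[of a "(norm h)\<^sup>2"] by blast
  \<comment> \<open>Comparing \<open>x\<close> with a point \<open>l n < x\<close> of the sequence
    replaces the norm of \<open>G x\<close> by the limit \<open>s\<close>. The bound covers every
    \<open>x\<close> below \<open>l N\<close>, not only points of the sequence, and so yields the
    limit along \<open>at_right 0\<close>.\<close>
  have near: "(norm (G x - G (l N)))\<^sup>2 \<le> s - a N" if "0 < x" "x \<le> l N" for x N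
  proof -
    obtain n where "l n < x" using reals_Archimedean[OF \<open>0 < x\<close>] unfolding l_def by blast
    then have "(norm (G x))\<^sup>2 \<le> a n" unfolding a_def using l by (intro mono) auto
    then show ?thesis using dist[OF that] s(2)[of n] unfolding a_def by linarith
  qed
  have ev: "\<exists>N. s - a N < e" if "e > 0" for e
  proof -
    have "\<forall>\<^sub>F n in sequentially. a n > s - e" using order_tendstoD(1)[OF s(1), of "s - e"] that by simp
    then obtain N where "a N > s - e" by (auto simp: eventually_sequentially)
    then show ?thesis by (intro exI[of _ N]) simp
  qed
  have "Cauchy (\<lambda>n. G (l n))"
    unfolding Cauchy_altdef2
  proof (intro allI impI)
    fix e :: real assume "e > 0"
    then obtain N where N: "s - a N < e\<^sup>2" using ev[of "e\<^sup>2"] by auto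
    have "dist (G (l n)) (G (l N)) < e" if "n \<ge> N" for n
    proof -
      have "l n \<le> l N" using that by (simp add: l_def)
      then have "(norm (G (l n) - G (l N)))\<^sup>2 < e\<^sup>2" using near[OF l, of n N] N by linarith
      then show ?thesis using \<open>e > 0\<close> by (simp add: dist_norm power2_less_imp_less)
    qed
    then show "\<exists>N. \<forall>n\<ge>N. dist (G (l n)) (G (l N)) < e" by blast
  qed
  then obtain g0 where g0: "(\<lambda>n. G (l n)) \<longlonglongrightarrow> g0"
    using Cauchy_convergent convergent_def by blast
  have lim: "(G \<longlongrightarrow> g0) (at_right 0)"
  proof (rule tendstoI)
    fix e :: real assume "e > 0"
    then obtain N where N: "s - a N < (e / 2)\<^sup>2" using ev[of "(e / 2)\<^sup>2"] by auto
    have G: "norm (G x - G (l N)) < e / 2" if "0 < x" "x \<le> l N" for x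
      using near[OF that] N \<open>e > 0\<close> by (intro power2_less_imp_less[of _ "e / 2"]) auto
    have "norm (g0 - G (l N)) \<le> e / 2"
    proof (rule LIMSEQ_le_const2)
      show "(\<lambda>n. norm (G (l n) - G (l N))) \<longlonglongrightarrow> norm (g0 - G (l N))"
        by (intro tendsto_intros g0)
      show "\<exists>M. \<forall>n\<ge>M. norm (G (l n) - G (l N)) \<le> e / 2"
        by (intro exI[of _ N] allI impI less_imp_le[OF G[OF l]]) (simp add: l_def)
    qed
    then have "dist (G x) g0 < e" if "0 < x" "x < l N" for x
      using G[of x] that dist_triangle2[of "G x" g0 "G (l N)"] by (simp add: dist_norm)
    then show "\<forall>\<^sub>F x in at_right 0. dist (G x) g0 < e"
      using l[of N] unfolding eventually_at_right_field by blast
  qed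
  \<comment> \<open>The risk of \<open>G x\<close> is at most its regularized risk, hence at most
    that of \<open>h\<close>, whose penalty vanishes with \<open>x\<close>.\<close>
  have "rkhs_risk fn \<rho> \<phi> g0 \<le> rkhs_risk fn \<rho> \<phi> h"
  proof (rule tendsto_le[OF _ _ rkhs_risk_tendsto[OF lim]])
    have "((\<lambda>x. rkhs_risk fn \<rho> \<phi> h + x / 2 * (norm h)\<^sup>2) \<longlongrightarrow>
        rkhs_risk fn \<rho> \<phi> h + 0 / 2 * (norm h)\<^sup>2) (at_right 0)"
      by (intro tendsto_intros) auto
    then show "((\<lambda>x. rkhs_risk fn \<rho> \<phi> h + x / 2 * (norm h)\<^sup>2) \<longlongrightarrow> rkhs_risk fn \<rho> \<phi> h) (at_right 0)"
      by simp
    show "\<forall>\<^sub>F x in at_right 0. rkhs_risk fn \<rho> \<phi> (G x) \<le> rkhs_risk fn \<rho> \<phi> h + x / 2 * (norm h)\<^sup>2"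
      using eventually_at_right_less[of 0]
    proof eventually_elim
      case (elim x)
      have "rkhs_risk fn \<rho> \<phi> (G x) \<le> reg_risk fn \<rho> \<phi> x (G x)"
        using elim by (simp add: reg_risk_def)
      also have "\<dots> \<le> reg_risk fn \<rho> \<phi> x h"
        unfolding G_def by (rule reg_minimizer_le[OF elim])
      finally show ?case by (simp add: reg_risk_def)
    qed
  qed simp
  then show ?thesis using that[of g0] lim min unfolding G_def by (blast intro: order_trans)
qed

end

section \<open>Bayes rules and the link function\<close>

locale kernel_classification = kernel_learning +
  fixes \<kappa> :: "'a \<Rightarrow> real measure"
  assumes cond: "conditional_distribution \<X> \<rho> \<kappa>"
begin

abbreviation \<mu> where "\<mu> \<equiv> marginal \<X> \<rho>"

definition \<eta> :: "'a \<Rightarrow> real" where "\<eta> x = measure (\<kappa> x) {1}"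

lemma kernel_measurable [measurable]: "\<kappa> \<in> measurable \<X> (prob_algebra (count_space {-1, 1}))"
  using cond by (simp add: conditional_distribution_def)

lemma sets_kappa: "sets (\<kappa> x) = Pow {-1, 1}" and prob_kappa: "prob_space (\<kappa> x)"
  using measurable_space[OF kernel_measurable, of x] by (simp_all add: space_X space_prob_algebra)

lemma space_kappa: "space (\<kappa> x) = {-1, 1}"
  using sets_eq_imp_space_eq[of "\<kappa> x" "count_space {-1, 1}"] by (simp add: sets_kappa)

lemma eta_measurable [measurable]: "\<eta> \<in> borel_measurable \<X>"
  unfolding \<eta>_def
  by (rule measurable_compose[OF kernel_measurable measurable_measure_prob_algebra]) auto

lemma eta_bounds: "0 \<le> \<eta> x" "\<eta> x \<le> 1"
  unfolding \<eta>_def using prob_space.prob_le_1[OF prob_kappa] by auto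

lemma measure_kappa_neg: "measure (\<kappa> x) {-1} = 1 - \<eta> x"
proof -
  have "{-1} = space (\<kappa> x) - {1}" by (auto simp: space_kappa)
  then show ?thesis
    using prob_space.prob_compl[OF prob_kappa, of "{1}" x] by (simp add: \<eta>_def sets_kappa)
qed

lemma sets_marginal [measurable_cong]: "sets \<mu> = sets \<X>"
  by (simp add: marginal_def)

text \<open>The conditional distribution describes \<open>\<rho>\<close> on rectangles. Restricting
  to one label and projecting gives two measures on the feature space that agree on every set, hence
  integrate every \<open>u\<close> alike.\<close>

lemma nn_integral_label:
  assumes u [measurable]: "u \<in> borel_measurable \<X>" and y: "y \<in> {-1, 1}"
  shows "(\<integral>\<^sup>+ z. u (fst z) * indicator {y} (snd z) \<partial>\<rho>) = (\<integral>\<^sup>+ x. u x * ennreal (measure (\<kappa> x) {y}) \<partial>\<mu>)"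
proof -
  have [measurable]: "(\<lambda>x. measure (\<kappa> x) {y}) \<in> borel_measurable \<X>"
    using y by (intro measurable_compose[OF kernel_measurable measurable_measure_prob_algebra]) auto
  then have [measurable]: "(\<lambda>x. measure (\<kappa> x) {y}) \<in> borel_measurable \<mu>"
    by (simp add: measurable_cong_sets[OF sets_marginal refl])
  have "distr (density \<rho> (\<lambda>z. indicator {y} (snd z))) \<X> fst = density \<mu> (\<lambda>x. ennreal (measure (\<kappa> x) {y}))"
    (is "?A = ?B")
  proof (rule measure_eqI)
    fix A assume "A \<in> sets ?A"
    then have A [measurable]: "A \<in> sets \<X>" by simp
    have "emeasure ?A A = (\<integral>\<^sup>+ z. indicator {y} (snd z) * indicator (fst -` A \<inter> space \<rho>) z \<partial>\<rho>)"
      by (subst emeasure_distr) (auto simp: emeasure_density)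
    also have "\<dots> = (\<integral>\<^sup>+ z. indicator (A \<times> {y}) z \<partial>\<rho>)"
      by (intro nn_integral_cong) (auto simp: indicator_def split: if_splits)
    also have "\<dots> = emeasure \<rho> (A \<times> {y})"
    proof (rule nn_integral_indicator)
      show "A \<times> {y} \<in> sets \<rho>" using A y by (auto simp: sets_rho)
    qed
    also have "\<dots> = (\<integral>\<^sup>+ x\<in>A. emeasure (\<kappa> x) {y} \<partial>\<mu>)"
      using cond A y unfolding conditional_distribution_def by blast
    also have "\<dots> = emeasure ?B A"
      by (subst emeasure_density)
         (auto simp: finite_measure.emeasure_eq_measure[OF prob_space.finite_measure[OF prob_kappa]])
    finally show "emeasure ?A A = emeasure ?B A" .
  qed (simp add: sets_marginal)
  then have "(\<integral>\<^sup>+ x. u x \<partial>?A) = (\<integral>\<^sup>+ x. u x \<partial>?B)" by simp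
  then show ?thesis
    by (simp add: nn_integral_distr nn_integral_density mult.commute)
qed

text \<open>Splitting by label turns the risk into an integral over features alone, where
  minimization can be done pointwise.\<close>

lemma risk_eq_pointwise:
  assumes [measurable]: "f \<in> borel_measurable \<X>"
  shows "risk \<rho> \<phi> f = (\<integral>\<^sup>+ x. ennreal (pointwise_risk \<phi> (\<eta> x) (f x)) \<partial>\<mu>)"
proof -
  have "risk \<rho> \<phi> f = (\<integral>\<^sup>+ z. ennreal (\<phi> (f (fst z))) * indicator {1} (snd z) +
      ennreal (\<phi> (- f (fst z))) * indicator {-1} (snd z) \<partial>\<rho>)"
    unfolding risk_def loss_def
  proof (rule nn_integral_cong)
    fix z assume "z \<in> space \<rho>"
    then have "snd z = 1 \<or> snd z = -1" using snd_in[of z] by auto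
    then show "ennreal (\<phi> (snd z * f (fst z))) = ennreal (\<phi> (f (fst z))) * indicator {1} (snd z) +
      ennreal (\<phi> (- f (fst z))) * indicator {-1} (snd z)"
      by auto
  qed
  also have "\<dots> = (\<integral>\<^sup>+ z. ennreal (\<phi> (f (fst z))) * indicator {1} (snd z) \<partial>\<rho>) +
      (\<integral>\<^sup>+ z. ennreal (\<phi> (- f (fst z))) * indicator {-1} (snd z) \<partial>\<rho>)"
    by (intro nn_integral_add) auto
  also have "\<dots> = (\<integral>\<^sup>+ x. ennreal (\<phi> (f x)) * ennreal (\<eta> x) \<partial>\<mu>) +
      (\<integral>\<^sup>+ x. ennreal (\<phi> (- f x)) * ennreal (1 - \<eta> x) \<partial>\<mu>)"
    using nn_integral_label[of "\<lambda>x. ennreal (\<phi> (f x))" 1] nn_integral_label[of "\<lambda>x. ennreal (\<phi> (- f x))" "-1"]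
    by (simp add: measure_kappa_neg flip: \<eta>_def)
  also have "\<dots> = (\<integral>\<^sup>+ x. ennreal (\<phi> (f x)) * ennreal (\<eta> x) + ennreal (\<phi> (- f x)) * ennreal (1 - \<eta> x) \<partial>\<mu>)"
    by (intro nn_integral_add[symmetric]) auto
  also have "\<dots> = (\<integral>\<^sup>+ x. ennreal (pointwise_risk \<phi> (\<eta> x) (f x)) \<partial>\<mu>)"
    by (intro nn_integral_cong)
       (simp add: pointwise_risk_def eta_bounds phi_nonneg ennreal_mult ennreal_plus mult.commute)
  finally show ?thesis .
qed

lemma cond_mean_eq: "cond_mean \<kappa> x = 2 * \<eta> x - 1"
proof -
  interpret P: prob_space "\<kappa> x" by (rule prob_kappa)
  \<comment> \<open>On the two labels the identity function equals
    \<open>2 * indicator {1} y - 1\<close>.\<close>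
  have "cond_mean \<kappa> x = (LINT y|\<kappa> x. 2 * indicator {1} y - 1)"
    unfolding cond_mean_def
    by (intro Bochner_Integration.integral_cong) (auto simp: space_kappa indicator_def)
  also have "\<dots> = 2 * (LINT y|\<kappa> x. indicator {1} y) - (LINT y|\<kappa> x. 1)"
    by (subst Bochner_Integration.integral_diff)
       (auto simp: sets_kappa intro!: P.integrable_const_bound[where B = 1] borel_measurable_indicator)
  also have "\<dots> = 2 * \<eta> x - 1"
    using P.prob_space by (simp add: \<eta>_def space_kappa)
  finally show ?thesis .
qed

text \<open>The link minimizes the pointwise risk at almost every \<open>x\<close>, and monotonicity
  makes it Borel. Outside the open interval the value 0 is a placeholder on a null set.\<close>

lemma link_comp_bayes_rule:
  assumes eta: "AE x in \<mu>. \<eta> x \<in> {0<..<1}"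
    and link: "link_well_defined \<phi>"
    and mono: "mono_on {0<..<1} (link \<phi>)"
  shows "bayes_rule \<X> \<rho> \<phi> (\<lambda>x. if \<eta> x \<in> {0<..<1} then link \<phi> (\<eta> x) else 0)"
    (is "bayes_rule \<X> \<rho> \<phi> ?f")
proof -
  have [measurable]: "(\<lambda>t. if t \<in> {0<..<1} then link \<phi> t else 0) \<in> borel_measurable borel"
    using borel_measurable_mono_on_fnc[OF mono]
    by (simp add: measurable_If_restrict_space_iff del: greaterThanLessThan_iff)
  have f [measurable]: "?f \<in> borel_measurable \<X>"
    by (rule measurable_compose[OF eta_measurable]) measurable
  have opt: "pointwise_risk \<phi> t (link \<phi> t) \<le> pointwise_risk \<phi> t h" if "t \<in> {0<..<1}" for t h
  proof -
    have "\<exists>h. is_arg_min (pointwise_risk \<phi> t) (\<lambda>_. True) h"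
      using link that unfolding link_well_defined_def by blast
    then have "is_arg_min (pointwise_risk \<phi> t) (\<lambda>_. True) (link \<phi> t)"
      unfolding link_def arg_min_def by (rule someI_ex)
    then show ?thesis by (simp add: is_arg_min_linorder)
  qed
  have "risk \<rho> \<phi> ?f \<le> risk \<rho> \<phi> h" if h: "h \<in> borel_measurable \<X>" for h
    unfolding risk_eq_pointwise[OF f] risk_eq_pointwise[OF h]
  proof (rule nn_integral_mono_AE)
    show "AE x in \<mu>. ennreal (pointwise_risk \<phi> (\<eta> x) (?f x)) \<le> ennreal (pointwise_risk \<phi> (\<eta> x) (h x))"
      using eta by eventually_elim (auto intro!: ennreal_leI opt)
  qed
  with f show ?thesis by (simp add: bayes_rule_def)
qed

end

section \<open>Exponential moments of the stochastic gradient step\<close>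

context kernel_learning
begin

lemma inner_stoch_grad:
  "inner (stoch_grad fn k \<phi> lam g z) e = dloss \<phi> (fn g (fst z)) (snd z) * fn e (fst z) + lam * inner g e"
  by (simp add: stoch_grad_def inner_add_left fn_eq[of e] inner_commute[of e])

lemma dloss_fn_bound:
  assumes "z \<in> space \<rho>"
  shows "\<bar>dloss \<phi> (fn g (fst z)) (snd z) * fn e (fst z)\<bar> \<le> M * R * norm e"
  using mult_mono[OF dloss_bound[OF snd_in[OF assms]] fn_bound] M_pos
  by (simp add: abs_mult mult.assoc)

lemma dloss_fn_measurable [measurable]:
  "(\<lambda>z. dloss \<phi> (fn g (fst z)) (snd z) * fn e (fst z)) \<in> borel_measurable \<rho>"
  by measurable

lemma dloss_fn_integrable:
  "integrable \<rho> (\<lambda>z. dloss \<phi> (fn g (fst z)) (snd z) * fn e (fst z))"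
proof (rule integrable_const_bound)
  show "AE z in \<rho>. norm (dloss \<phi> (fn g (fst z)) (snd z) * fn e (fst z)) \<le> M * R * norm e"
    using dloss_fn_bound by (intro AE_I2) simp
qed measurable

lemma norm_stoch_grad:
  assumes "z \<in> space \<rho>" "lam \<ge> 0"
  shows "norm (stoch_grad fn k \<phi> lam g z) \<le> M * R + lam * norm g"
proof -
  have "norm (dloss \<phi> (fn g (fst z)) (snd z) *\<^sub>R K (fst z)) \<le> M * R"
    using mult_mono[OF dloss_bound[OF snd_in[OF assms(1)]] norm_K] M_pos by simp
  then show ?thesis
    unfolding stoch_grad_def using assms(2) by (intro order_trans[OF norm_triangle_ineq]) simp
qed

text \<open>The tangent of the loss controls the risk difference. One half of the constant
  \<open>lam\<close> comes from expanding \<open>inner g e\<close>, the other from growth of the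
  regularized risk at its minimizer; the gradient of the risk never appears.\<close>

lemma stoch_grad_drift:
  fixes g
  assumes "lam > 0"
  defines "e \<equiv> g - reg_minimizer fn \<rho> \<phi> lam"
  shows "lam * (norm e)\<^sup>2 \<le> (LINT z|\<rho>. inner (stoch_grad fn k \<phi> lam g z) e)"
proof -
  define h where "h = reg_minimizer fn \<rho> \<phi> lam"
  let ?l = "\<lambda>g z. loss \<phi> (fn g (fst z)) (snd z)"
  let ?d = "\<lambda>z. dloss \<phi> (fn g (fst z)) (snd z) * fn e (fst z)"
  have "rkhs_risk fn \<rho> \<phi> g - rkhs_risk fn \<rho> \<phi> h = (LINT z|\<rho>. ?l g z - ?l h z)"
    unfolding rkhs_risk_eq by (simp add: loss_integrable)
  also have "\<dots> \<le> (LINT z|\<rho>. ?d z)"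
  proof (rule integral_mono)
    fix z
    have "?l g z + dloss \<phi> (fn g (fst z)) (snd z) * (fn h (fst z) - fn g (fst z)) \<le> ?l h z"
      by (rule loss_tangent)
    then show "?l g z - ?l h z \<le> ?d z"
      unfolding e_def h_def[symmetric] fn_diff by (simp add: algebra_simps)
  qed (auto simp: loss_integrable dloss_fn_integrable)
  finally have 1: "rkhs_risk fn \<rho> \<phi> g - rkhs_risk fn \<rho> \<phi> h \<le> (LINT z|\<rho>. ?d z)" .
  have 2: "(norm e)\<^sup>2 = (norm h)\<^sup>2 - (norm g)\<^sup>2 + 2 * inner g e"
    unfolding e_def h_def[symmetric] power2_norm_eq_inner
    by (simp add: inner_diff_left inner_diff_right inner_commute[of h g])
  have 3: "lam * (norm e)\<^sup>2 = lam * (norm h)\<^sup>2 - lam * (norm g)\<^sup>2 + 2 * (lam * inner g e)"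
    unfolding 2 by (simp add: algebra_simps)
  have "rkhs_risk fn \<rho> \<phi> h + lam / 2 * (norm h)\<^sup>2 + lam / 2 * (norm e)\<^sup>2
      \<le> rkhs_risk fn \<rho> \<phi> g + lam / 2 * (norm g)\<^sup>2"
    using reg_risk_growth[OF \<open>lam > 0\<close>, of g] unfolding reg_risk_def e_def h_def .
  then have "lam * (norm e)\<^sup>2 \<le> (LINT z|\<rho>. ?d z) + lam * inner g e"
    using 1 3 by linarith
  also have "\<dots> = (LINT z|\<rho>. inner (stoch_grad fn k \<phi> lam g z) e)"
    unfolding inner_stoch_grad by (simp add: dloss_fn_integrable prob_space)
  finally show ?thesis .
qed

text \<open>The drift handles the mean and Hoeffding's lemma the fluctuation. The range is
  proportional to \<open>norm e\<close>, so the variance term scales with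
  \<open>(norm e)\<^sup>2\<close>, as the drift does.\<close>

lemma stoch_grad_exp_moment:
  fixes g
  assumes "lam > 0" "s > 0"
  defines "e \<equiv> g - reg_minimizer fn \<rho> \<phi> lam"
  shows "(\<integral>\<^sup>+ z. ennreal (exp (- (s * inner (stoch_grad fn k \<phi> lam g z) e))) \<partial>\<rho>)
    \<le> ennreal (exp (- (s * lam * (norm e)\<^sup>2) + s\<^sup>2 * M\<^sup>2 * R\<^sup>2 * (norm e)\<^sup>2 / 2))"
proof -
  let ?f = "\<lambda>z. - inner (stoch_grad fn k \<phi> lam g z) e"
  define B where "B = M * R * norm e"
  \<comment> \<open>Only the loss term is random; the penalty shifts the centre of an interval of
    length \<open>2 * B\<close>.\<close>
  interpret f: interval_bounded_random_variable \<rho> ?f "- (lam * inner g e) - B" "- (lam * inner g e) + B"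
  proof
    show "?f \<in> borel_measurable \<rho>"
      unfolding inner_stoch_grad by measurable
    show "AE z in \<rho>. ?f z \<in> {- (lam * inner g e) - B..- (lam * inner g e) + B}"
    proof (rule AE_I2)
      fix z assume "z \<in> space \<rho>"
      from dloss_fn_bound[OF this, of g e] show "?f z \<in> {- (lam * inner g e) - B..- (lam * inner g e) + B}"
        unfolding inner_stoch_grad B_def by (simp add: abs_le_iff)
    qed
  qed
  define m where "m = expectation ?f"
  have m: "m \<le> - (lam * (norm e)\<^sup>2)"
    using stoch_grad_drift[OF \<open>lam > 0\<close>, of g] by (simp add: m_def e_def)
  have [measurable]: "?f \<in> borel_measurable \<rho>" by (rule f.random_variable)
  have "(\<integral>\<^sup>+ z. ennreal (exp (- (s * inner (stoch_grad fn k \<phi> lam g z) e))) \<partial>\<rho>)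
      = (\<integral>\<^sup>+ z. ennreal (exp (s * m)) * ennreal (exp (s * (?f z - m))) \<partial>\<rho>)"
    by (intro nn_integral_cong) (simp add: algebra_simps flip: ennreal_mult exp_add)
  also have "\<dots> = ennreal (exp (s * m)) * (\<integral>\<^sup>+ z. ennreal (exp (s * (?f z - m))) \<partial>\<rho>)"
    by (intro nn_integral_cmult) measurable
  also have "\<dots> \<le> ennreal (exp (s * m)) * ennreal (exp (s\<^sup>2 * (2 * B)\<^sup>2 / 8))"
    using f.Hoeffdings_lemma_nn_integral[OF \<open>s > 0\<close>] by (intro mult_left_mono) (simp_all add: m_def)
  also have "\<dots> = ennreal (exp (s * m + s\<^sup>2 * (2 * B)\<^sup>2 / 8))"
    by (simp add: exp_add flip: ennreal_mult)
  also have "\<dots> \<le> ennreal (exp (- (s * lam * (norm e)\<^sup>2) + s\<^sup>2 * M\<^sup>2 * R\<^sup>2 * (norm e)\<^sup>2 / 2))"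
  proof (intro ennreal_leI iffD2[OF exp_le_cancel_iff] add_mono)
    show "s * m \<le> - (s * lam * (norm e)\<^sup>2)"
      using mult_left_mono[OF m, of s] \<open>s > 0\<close> by (simp add: mult.assoc)
    show "s\<^sup>2 * (2 * B)\<^sup>2 / 8 \<le> s\<^sup>2 * M\<^sup>2 * R\<^sup>2 * (norm e)\<^sup>2 / 2"
      by (simp add: B_def power_mult_distrib)
  qed
  finally show ?thesis .
qed

text \<open>Here \<open>c\<close> stands for \<gamma> + t. Expanding the square gives a cross term
  whose coefficient \<open>s\<close> does not depend on \<open>c\<close>: the drift contributes
  \<open>- 4 * q\<close> and Hoeffding \<open>q\<close>, hence \<open>c - 3\<close>. The bound
  \<open>3 * (M * R)\<close> on the stochastic gradient produces \<open>9 / (2 * c)\<close>.\<close>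

lemma sgd_step_exp_moment:
  assumes lam: "lam > 0" and "c > 0" and g: "lam * norm g \<le> 2 * (M * R)"
  defines "h \<equiv> reg_minimizer fn \<rho> \<phi> lam" and "q \<equiv> lam\<^sup>2 / (8 * M\<^sup>2 * R\<^sup>2)"
  shows "(\<integral>\<^sup>+ z. ennreal (exp (q * c *
      (norm (g - (2 / (lam * c)) *\<^sub>R stoch_grad fn k \<phi> lam g z - h))\<^sup>2)) \<partial>\<rho>)
    \<le> ennreal (exp (q * (c - 3) * (norm (g - h))\<^sup>2 + 9 / (2 * c)))"
proof -
  define e where "e = g - h"
  define s where "s = lam / (2 * M\<^sup>2 * R\<^sup>2)"
  define w where "w = 2 / (lam * c)"
  let ?G = "stoch_grad fn k \<phi> lam g"
  have MR: "M * R > 0" using M_pos R_pos by simp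
  have s: "s > 0" using lam M_pos R_pos by (simp add: s_def)
  have q: "q > 0" using lam M_pos R_pos by (simp add: q_def)
  \<comment> \<open>The value of \<open>q\<close> makes the Hoeffding term exactly \<open>q\<close>
    times the squared distance, a quarter of the drift.\<close>
  have qcw: "2 * q * c * w = s" "q * c * w\<^sup>2 * (3 * (M * R))\<^sup>2 = 9 / (2 * c)"
    "s * lam = 4 * q" "s\<^sup>2 * M\<^sup>2 * R\<^sup>2 / 2 = q"
    unfolding q_def w_def s_def using lam M_pos R_pos \<open>c > 0\<close>
    by (simp_all add: field_simps power2_eq_square)
  have "q * c * (norm (g - w *\<^sub>R ?G z - h))\<^sup>2
      \<le> q * c * (norm e)\<^sup>2 + 9 / (2 * c) - s * inner (?G z) e" if z: "z \<in> space \<rho>" for z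
  proof -
    have "norm (?G z) \<le> 3 * (M * R)"
      using norm_stoch_grad[OF z, of lam g] lam g by simp
    then have "(norm (?G z))\<^sup>2 \<le> (3 * (M * R))\<^sup>2" by (intro power_mono) auto
    then have G: "q * c * w\<^sup>2 * (norm (?G z))\<^sup>2 \<le> q * c * w\<^sup>2 * (3 * (M * R))\<^sup>2"
      using q \<open>c > 0\<close> by (intro mult_left_mono) auto
    have eq: "g - w *\<^sub>R ?G z - h = e - w *\<^sub>R ?G z" by (simp add: e_def)
    have "q * c * (norm (g - w *\<^sub>R ?G z - h))\<^sup>2 =
        q * c * (norm e)\<^sup>2 - (2 * q * c * w) * inner e (?G z) + q * c * w\<^sup>2 * (norm (?G z))\<^sup>2"
      unfolding eq norm_sq_diff_scaleR by (simp add: algebra_simps)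
    with G show ?thesis unfolding qcw by (simp add: inner_commute)
  qed
  then have "(\<integral>\<^sup>+ z. ennreal (exp (q * c * (norm (g - w *\<^sub>R ?G z - h))\<^sup>2)) \<partial>\<rho>)
      \<le> (\<integral>\<^sup>+ z. ennreal (exp (q * c * (norm e)\<^sup>2 + 9 / (2 * c))) * ennreal (exp (- (s * inner (?G z) e))) \<partial>\<rho>)"
    by (intro nn_integral_mono) (simp flip: ennreal_mult exp_add)
  also have "\<dots> = ennreal (exp (q * c * (norm e)\<^sup>2 + 9 / (2 * c))) *
      (\<integral>\<^sup>+ z. ennreal (exp (- (s * inner (?G z) e))) \<partial>\<rho>)"
    unfolding inner_stoch_grad by (intro nn_integral_cmult) measurable
  also have "\<dots> \<le> ennreal (exp (q * c * (norm e)\<^sup>2 + 9 / (2 * c))) *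
      ennreal (exp (- (s * lam * (norm e)\<^sup>2) + s\<^sup>2 * M\<^sup>2 * R\<^sup>2 * (norm e)\<^sup>2 / 2))"
    unfolding e_def h_def by (intro mult_left_mono stoch_grad_exp_moment lam s) simp
  also have "\<dots> = ennreal (exp (q * (c - 3) * (norm e)\<^sup>2 + 9 / (2 * c)))"
  proof -
    have "- (s * lam * (norm e)\<^sup>2) + s\<^sup>2 * M\<^sup>2 * R\<^sup>2 * (norm e)\<^sup>2 / 2
        = - (s * lam * (norm e)\<^sup>2) + (s\<^sup>2 * M\<^sup>2 * R\<^sup>2 / 2) * (norm e)\<^sup>2" by simp
    also have "\<dots> = - (3 * q * (norm e)\<^sup>2)"
      unfolding qcw by simp
    finally show ?thesis by (simp add: algebra_simps flip: ennreal_mult exp_add)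
  qed
  finally show ?thesis unfolding e_def w_def .
qed

text \<open>No separability of the Hilbert space is assumed, so a random element of it is
  handled through the real random variables that determine the quantities of interest.\<close>

definition weakly_measurable :: "'w measure \<Rightarrow> ('w \<Rightarrow> 'h) \<Rightarrow> bool" where
  "weakly_measurable N U \<longleftrightarrow>
     (\<forall>v. (\<lambda>w. inner (U w) v) \<in> borel_measurable N) \<and>
     (\<lambda>w. (norm (U w))\<^sup>2) \<in> borel_measurable N \<and>
     (\<lambda>p. fn (U (fst p)) (snd p)) \<in> borel_measurable (N \<Otimes>\<^sub>M \<X>)"

lemma weakly_measurable_const: "weakly_measurable N (\<lambda>_. g)"
  unfolding weakly_measurable_def by simp

lemma weakly_measurable_dist:
  assumes "weakly_measurable N U"
  shows "(\<lambda>w. (norm (U w - v))\<^sup>2) \<in> borel_measurable N"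
proof -
  have [measurable]: "(\<lambda>w. inner (U w) v) \<in> borel_measurable N" "(\<lambda>w. (norm (U w))\<^sup>2) \<in> borel_measurable N"
    using assms unfolding weakly_measurable_def by blast+
  have "(norm (U w - v))\<^sup>2 = (norm (U w))\<^sup>2 - 2 * inner (U w) v + (norm v)\<^sup>2" for w
    using norm_sq_diff_scaleR[of "U w" 1 v] by simp
  then show ?thesis by simp
qed

text \<open>A step returns a linear combination of the iterate and a kernel section, so each of the
  three quantities is an arithmetic expression in measurable real variables.\<close>

lemma weakly_measurable_sgd_step:
  assumes U: "weakly_measurable N U" and f [measurable]: "f \<in> measurable N \<rho>"
  shows "weakly_measurable N (\<lambda>w. U w - c *\<^sub>R stoch_grad fn k \<phi> lam (U w) (f w))"
proof -
  have [measurable]: "(\<lambda>w. inner (U w) v) \<in> borel_measurable N" "(\<lambda>w. (norm (U w))\<^sup>2) \<in> borel_measurable N"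
      "(\<lambda>p. fn (U (fst p)) (snd p)) \<in> borel_measurable (N \<Otimes>\<^sub>M \<X>)" for v
    using U unfolding weakly_measurable_def by blast+
  have [measurable]: "(\<lambda>w. fst (f w)) \<in> measurable N \<X>" "(\<lambda>w. snd (f w)) \<in> borel_measurable N"
    using measurable_compose[OF f fst_rho] measurable_compose[OF f snd_rho] by auto
  define u where "u = (\<lambda>w. fn (U w) (fst (f w)))"
  \<comment> \<open>A random function is evaluated at a random point; the joint measurability in the
    third clause of the definition is there for this.\<close>
  have "(\<lambda>w. (\<lambda>p. fn (U (fst p)) (snd p)) (w, fst (f w))) \<in> borel_measurable N"
    by measurable
  then have [measurable]: "u \<in> borel_measurable N" by (simp add: u_def)
  define d where "d = (\<lambda>w. dloss \<phi> (u w) (snd (f w)))"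
  have [measurable]: "d \<in> borel_measurable N" unfolding d_def by measurable
  have step: "U w - c *\<^sub>R stoch_grad fn k \<phi> lam (U w) (f w) =
      (1 - c * lam) *\<^sub>R U w - (c * d w) *\<^sub>R K (fst (f w))" for w
    by (simp add: stoch_grad_def d_def u_def scaleR_diff_left scaleR_add_right)
  have norm: "(norm ((1 - c * lam) *\<^sub>R U w - (c * d w) *\<^sub>R K (fst (f w))))\<^sup>2 =
      (1 - c * lam)\<^sup>2 * (norm (U w))\<^sup>2 - 2 * (c * d w) * ((1 - c * lam) * u w)
      + (c * d w)\<^sup>2 * k (fst (f w)) (fst (f w))" for w
    unfolding norm_sq_diff_scaleR
    by (simp add: power_mult_distrib u_def fn_eq flip: power2_norm_eq_inner[symmetric] inner_K_K)
  show ?thesis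
    unfolding weakly_measurable_def step norm fn_diff fn_scaleR inner_diff_left inner_scaleR_left
      fn_K inner_commute[of "K _"] fn_eq[symmetric]
    by (intro conjI allI) measurable
qed

end

section \<open>Exponential moments of the averaged iterate\<close>

text \<open>Convexity of exp between 0 and \<open>u\<close>. It converts a contraction of the
  exponent into an affine recursion for the exponential moment.\<close>

lemma exp_scale_le:
  fixes u t :: real
  assumes "0 \<le> t" "t \<le> 1"
  shows "exp (t * u) \<le> t * exp u + (1 - t)"
  using convex_onD[OF convex_on_exp[of 1] assms, of 0 u] by simp

lemma convex_on_norm_square: "convex_on UNIV (\<lambda>x::'h::real_inner. (norm x)\<^sup>2)"
  by (intro convex_onI) (simp_all add: norm_sq_convex_comb)

text \<open>Partial fractions: with \<open>a = c + real t - 2\<close> the summand is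
  \<open>(c - 1) * (c - 2)\<close> times \<open>1 / (a - 1) - 1 / a\<close>. The sum is needed for
  the transient part of \<open>log_mgf_bound\<close>.\<close>

lemma sum_telescope_rational:
  fixes c :: real
  assumes "c > 2"
  shows "(\<Sum>t = 1..n + 1. (c - 1) * (c - 2) / ((c + real t - 2) * (c + real t - 3)))
    = (c - 1) * (real n + 1) / (c + real n - 1)"
proof (induction n)
  case 0
  then show ?case using assms by simp
next
  case (Suc n)
  define d where "d = c + real n - 1"
  have d: "d > 0" using assms by (simp add: d_def)
  have n: "real n = d + 1 - c" by (simp add: d_def)
  have "(c - 1) * (real n + 1) / d + (c - 1) * (c - 2) / ((d + 1) * d)
      = (c - 1) * (real n + 2) / (d + 1)"
    using d unfolding n by (simp add: divide_simps) (simp add: algebra_simps)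
  then show ?case using Suc by (simp add: d_def add_diff_eq add.commute add.left_commute)
qed

lemma sum_avg_weight:
  assumes "\<gamma> > 0"
  shows "(\<Sum>t = 1..T + 1. avg_weight \<gamma> T t) = 1"
proof -
  have "(\<Sum>t = 1..n + 1. 2 * (\<gamma> + real t - 1)) = (2 * \<gamma> + real n) * (real n + 1)" for n
    by (induction n) (simp_all add: algebra_simps)
  then show ?thesis
    using assms by (simp add: avg_weight_def del: sum.cl_ivl_Suc flip: sum_divide_distrib)
qed

text \<open>Iterate \<open>t\<close> looks only at samples before \<open>t\<close>; this is how
  independence of the fresh sample enters.\<close>

lemma sgd_cong:
  assumes "\<And>s. 1 \<le> s \<Longrightarrow> s < t \<Longrightarrow> z s = z' s"
  shows "sgd fn k \<phi> lam \<gamma> g1 z t = sgd fn k \<phi> lam \<gamma> g1 z' t"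
  using assms
proof (induction t)
  case (Suc t)
  then show ?case by (cases "t = 0") simp_all
qed simp

text \<open>\<open>\<gamma> \<ge> 3\<close> and the bound on \<open>g1\<close> are the form in which
  the conditions on the first step size and on the initial function are used.\<close>

locale kernel_sgd = kernel_learning \<rho> \<X> fn k \<phi> M R
  for \<rho> :: "('x \<times> real) measure" and \<X>
    and fn :: "'h::{real_inner, complete_space} \<Rightarrow> 'x \<Rightarrow> real" and k \<phi> M R +
  fixes lam \<gamma> :: real and g1 :: 'h and T :: nat
  assumes lam: "lam > 0" and gamma: "\<gamma> \<ge> 3" and norm_g1: "lam * norm g1 \<le> 2 * (M * R)"
begin

abbreviation iter :: "nat \<Rightarrow> (nat \<Rightarrow> 'x \<times> real) \<Rightarrow> 'h" where
  "iter t z \<equiv> sgd fn k \<phi> lam \<gamma> g1 z t"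

abbreviation opt :: 'h where "opt \<equiv> reg_minimizer fn \<rho> \<phi> lam"

abbreviation P :: "(nat \<Rightarrow> 'x \<times> real) measure" where "P \<equiv> PiM {1..T} (\<lambda>_. \<rho>)"

definition q :: real where "q = lam\<^sup>2 / (8 * M\<^sup>2 * R\<^sup>2)"

definition sqdist :: "nat \<Rightarrow> (nat \<Rightarrow> 'x \<times> real) \<Rightarrow> real" where
  "sqdist t z = (norm (iter t z - opt))\<^sup>2"

lemma q_pos: "q > 0"
  using lam M_pos R_pos by (simp add: q_def)

lemma iter_Suc:
  "t \<ge> 1 \<Longrightarrow> iter (Suc t) z =
    iter t z - (2 / (lam * (\<gamma> + real t))) *\<^sub>R stoch_grad fn k \<phi> lam (iter t z) (z t)"
  by (simp add: step_size_def)

text \<open>The ball of radius \<open>2 * (M * R) / lam\<close> is invariant: a step is the convex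
  combination, with weights \<open>1 - w\<close> and \<open>w\<close>, of the iterate and
  \<open>- d / lam\<close>, where \<open>norm d \<le> M * R\<close>.\<close>

lemma norm_iter:
  assumes "\<And>s. 1 \<le> s \<Longrightarrow> s < t \<Longrightarrow> z s \<in> space \<rho>"
  shows "lam * norm (iter t z) \<le> 2 * (M * R)"
  using assms
proof (induction t)
  case (Suc t)
  show ?case
  proof (cases "t = 0")
    case False
    define w where "w = 2 / (\<gamma> + real t)"
    define d where "d = dloss \<phi> (fn (iter t z) (fst (z t))) (snd (z t)) *\<^sub>R K (fst (z t))"
    have w: "0 \<le> w" "w \<le> 1" using gamma by (simp_all add: w_def)
    have z: "z t \<in> space \<rho>" using Suc.prems[of t] False by simp
    have d: "norm d \<le> M * R"
      unfolding d_def using mult_mono[OF dloss_bound[OF snd_in[OF z]] norm_K] M_pos by simp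
    have t1: "t \<ge> 1" using False by simp
    have wl: "2 / (lam * (\<gamma> + real t)) = w / lam" "w / lam * lam = w"
      using lam by (simp_all add: w_def)
    have eq: "iter (Suc t) z = (1 - w) *\<^sub>R iter t z - (w / lam) *\<^sub>R d"
      unfolding iter_Suc[of t z, OF t1]
        stoch_grad_def d_def[symmetric] wl
      using lam by (simp add: scaleR_add_right scaleR_diff_left)
    have "lam * norm (iter (Suc t) z) \<le> lam * ((1 - w) * norm (iter t z) + w / lam * norm d)"
      unfolding eq using w lam by (intro mult_left_mono order_trans[OF norm_triangle_ineq4]) simp_all
    also have "\<dots> = (1 - w) * (lam * norm (iter t z)) + w * norm d"
      using lam by (simp add: field_simps)
    also have "\<dots> \<le> (1 - w) * (2 * (M * R)) + w * (2 * (M * R))"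
      using w d Suc M_pos R_pos by (intro add_mono mult_left_mono) (auto intro: order_trans)
    finally show ?thesis by (simp add: algebra_simps)
  qed (use norm_g1 in simp)
qed (use norm_g1 in simp)

lemma weakly_measurable_iter:
  "t \<le> T + 1 \<Longrightarrow> weakly_measurable P (iter t)"
proof (induction t)
  case 0
  then show ?case by (simp add: weakly_measurable_const)
next
  case (Suc t)
  show ?case
  proof (cases "t = 0")
    case True
    then show ?thesis by (simp add: weakly_measurable_const)
  next
    case False
    then have "(\<lambda>z. z t) \<in> measurable P \<rho>"
      using Suc.prems by (intro measurable_component_singleton) auto
    then show ?thesis
      using weakly_measurable_sgd_step[OF Suc.IH] Suc.prems False by simp
  qed
qed

lemma sqdist_measurable: "t \<le> T + 1 \<Longrightarrow> sqdist t \<in> borel_measurable P"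
  unfolding sqdist_def by (intro weakly_measurable_dist weakly_measurable_iter)

text \<open>Proportional to \<open>avg_weight\<close> in \<open>t\<close>, so that averaging the
  exponents becomes uniform. At \<open>Suc t\<close> it is \<open>q * c\<close> with
  \<open>c = \<gamma> + real t\<close>, matching the one-step estimate.\<close>

definition weight :: "nat \<Rightarrow> real" where "weight t = q * (\<gamma> + real t - 1)"

text \<open>A supersolution of the recursion
  \<open>u (t + 1) = (1 - 2 / (\<gamma> + t - 1)) * u t + 9 / (2 * (\<gamma> + t))\<close> produced by the one-step
  estimate: \<open>9/4\<close> absorbs the inhomogeneous term, the rest solves the homogeneous recursion.\<close>

definition log_mgf_bound :: "nat \<Rightarrow> real" where
  "log_mgf_bound t = 9/4 +
     q * \<gamma> * (norm (g1 - opt))\<^sup>2 * ((\<gamma> - 1) * (\<gamma> - 2) / ((\<gamma> + real t - 2) * (\<gamma> + real t - 3)))"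

lemma log_mgf_bound_step:
  assumes "t \<ge> 1"
  defines "r \<equiv> (\<gamma> + real t - 3) / (\<gamma> + real t - 1)"
  shows "r * log_mgf_bound t + 9 / (2 * (\<gamma> + real t)) \<le> log_mgf_bound (Suc t)"
proof -
  define c where "c = \<gamma> + real t"
  have c: "c \<ge> 4" using gamma assms(1) by (simp add: c_def)
  define b where "b = q * \<gamma> * (norm (g1 - opt))\<^sup>2 * ((\<gamma> - 1) * (\<gamma> - 2))"
  have l: "log_mgf_bound t = 9/4 + b / ((c - 2) * (c - 3))"
      "log_mgf_bound (Suc t) = 9/4 + b / ((c - 1) * (c - 2))"
    by (simp_all add: log_mgf_bound_def b_def c_def)
  have "(c - 3) / (c - 1) * (b / ((c - 2) * (c - 3))) = b / ((c - 1) * (c - 2))"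
    using c by simp
  \<comment> \<open>The factor takes \<open>9 / (2 * (c - 1))\<close> off \<open>9/4\<close>, more
    than the term \<open>9 / (2 * c)\<close> puts back.\<close>
  moreover have "(c - 3) / (c - 1) * (9/4) + 9 / (2 * c) \<le> 9/4"
    using c by (simp add: field_simps)
  ultimately show ?thesis
    unfolding l r_def c_def[symmetric] distrib_left by linarith
qed

text \<open>After normalization by \<open>log_mgf_bound\<close> the bound is the constant 1. One
  step contracts the exponent by the factor \<open>r\<close>, and by induction
  \<open>r * ?F t z + (1 - r)\<close> has integral at most 1.\<close>

lemma sqdist_exp_moment:
  assumes "t \<ge> 1" "t \<le> T + 1"
  shows "(\<integral>\<^sup>+ z. ennreal (exp (weight t * sqdist t z - log_mgf_bound t)) \<partial>P) \<le> 1"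
  using assms
proof (induction t rule: dec_induct)
  case base
  \<comment> \<open>\<open>weight 1\<close> is \<open>q * \<gamma>\<close>, so the deterministic
    initial distance cancels and only \<open>9/4\<close> is left.\<close>
  have "weight 1 * sqdist 1 z - log_mgf_bound 1 = - (9/4)" for z
    using gamma by (simp add: weight_def sqdist_def log_mgf_bound_def)
  moreover have "emeasure P (space P) = 1"
    by (intro prob_space.emeasure_space_1 prob_space_PiM prob_space_axioms)
  ultimately show ?case by (simp add: ennreal_le_1)
next
  case (step t)
  then have t: "t \<ge> 1" "t \<le> T" by auto
  define I where "I = {1..T} - {t}"
  have I: "finite I" "t \<notin> I" "{1..T} = insert t I" using t by (auto simp: I_def)
  interpret prod: product_prob_space "\<lambda>_::nat. \<rho>" by standard
  define c where "c = \<gamma> + real t"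
  define r where "r = (c - 3) / (c - 1)"
  have r: "0 \<le> r" "r \<le> 1" using gamma t(1) by (auto simp: r_def c_def)
  let ?F = "\<lambda>t z. exp (weight t * sqdist t z - log_mgf_bound t)"
  have F [measurable]: "?F s \<in> borel_measurable P" if "s \<le> T + 1" for s
    using sqdist_measurable[OF that] by measurable
  \<comment> \<open>Coordinate \<open>t\<close> is integrated with all others fixed. The right-hand
    side stays an integral over \<open>y\<close>, although iterate \<open>t\<close> ignores that
    coordinate, so that the product formula can fold it back into an integral over
    \<open>P\<close>.\<close>
  have inner: "(\<integral>\<^sup>+ y. ennreal (?F (Suc t) (x(t := y))) \<partial>\<rho>) \<le>
      (\<integral>\<^sup>+ y. ennreal (r * ?F t (x(t := y)) + (1 - r)) \<partial>\<rho>)" if x: "x \<in> space (PiM I (\<lambda>_. \<rho>))" for x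
  proof -
    have same: "iter t (x(t := y)) = iter t x" for y
      by (rule sgd_cong) auto
    have nxt: "iter (Suc t) (x(t := y)) =
        iter t x - (2 / (lam * c)) *\<^sub>R stoch_grad fn k \<phi> lam (iter t x) y" for y
      unfolding iter_Suc[OF t(1)] same c_def by simp
    have "lam * norm (iter t x) \<le> 2 * (M * R)"
    proof (rule norm_iter)
      fix s assume "1 \<le> s" "s < t"
      then have "s \<in> I" using t(2) by (simp add: I_def)
      then show "x s \<in> space \<rho>" using x unfolding space_PiM by (rule PiE_mem[rotated])
    qed
    moreover have "c > 0" using gamma by (simp add: c_def)
    ultimately have "(\<integral>\<^sup>+ y. ennreal (exp (q * c * sqdist (Suc t) (x(t := y)))) \<partial>\<rho>)
        \<le> ennreal (exp (q * (c - 3) * sqdist t x + 9 / (2 * c)))"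
      unfolding sqdist_def nxt q_def by (intro sgd_step_exp_moment lam)
    note bound = this
    have "(\<integral>\<^sup>+ y. ennreal (?F (Suc t) (x(t := y))) \<partial>\<rho>)
        = (\<integral>\<^sup>+ y. ennreal (exp (- log_mgf_bound (Suc t))) *
            ennreal (exp (q * c * sqdist (Suc t) (x(t := y)))) \<partial>\<rho>)"
      by (intro nn_integral_cong)
         (simp add: weight_def c_def add.commute flip: ennreal_mult exp_add)
    also have "\<dots> = ennreal (exp (- log_mgf_bound (Suc t))) *
        (\<integral>\<^sup>+ y. ennreal (exp (q * c * sqdist (Suc t) (x(t := y)))) \<partial>\<rho>)"
    proof (rule nn_integral_cmult)
      have "weakly_measurable \<rho> (\<lambda>y. iter t x - (2 / (lam * c)) *\<^sub>R stoch_grad fn k \<phi> lam (iter t x) y)"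
        by (intro weakly_measurable_sgd_step weakly_measurable_const) simp
      from weakly_measurable_dist[OF this, of opt]
      show "(\<lambda>y. ennreal (exp (q * c * sqdist (Suc t) (x(t := y))))) \<in> borel_measurable \<rho>"
        unfolding sqdist_def nxt by measurable
    qed
    also have "\<dots> \<le> ennreal (exp (- log_mgf_bound (Suc t))) *
        ennreal (exp (q * (c - 3) * sqdist t x + 9 / (2 * c)))"
      by (intro mult_left_mono bound) simp
    also have "\<dots> = ennreal (exp (q * (c - 3) * sqdist t x + 9 / (2 * c) - log_mgf_bound (Suc t)))"
      by (simp flip: ennreal_mult exp_add)
    also have "\<dots> \<le> ennreal (exp (r * (weight t * sqdist t x - log_mgf_bound t)))"
    proof (intro ennreal_leI iffD2[OF exp_le_cancel_iff])
      \<comment> \<open>The contraction: the one-step coefficient \<open>q * (c - 3)\<close> against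
        the current weight \<open>q * (c - 1)\<close>.\<close>
      have "r * weight t = q * (c - 3)"
        using gamma t(1) by (simp add: r_def weight_def c_def)
      then have "r * (weight t * sqdist t x) = q * (c - 3) * sqdist t x"
        by (metis mult.assoc)
      then show "q * (c - 3) * sqdist t x + 9 / (2 * c) - log_mgf_bound (Suc t)
          \<le> r * (weight t * sqdist t x - log_mgf_bound t)"
        using log_mgf_bound_step[OF t(1)] unfolding c_def[symmetric] r_def[symmetric]
        unfolding right_diff_distrib[of r] by linarith
    qed
    also have "\<dots> \<le> ennreal (r * ?F t x + (1 - r))"
      by (intro ennreal_leI exp_scale_le r)
    also have "\<dots> = (\<integral>\<^sup>+ y. ennreal (r * ?F t (x(t := y)) + (1 - r)) \<partial>\<rho>)"
      by (simp add: sqdist_def same emeasure_space_1)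
    finally show ?thesis .
  qed
  have "(\<integral>\<^sup>+ z. ennreal (?F (Suc t) z) \<partial>P)
      = (\<integral>\<^sup>+ x. (\<integral>\<^sup>+ y. ennreal (?F (Suc t) (x(t := y))) \<partial>\<rho>) \<partial>PiM I (\<lambda>_. \<rho>))"
    unfolding I(3) by (rule prod.product_nn_integral_insert[OF I(1,2)])
      (use F[of "Suc t"] t(2) in \<open>simp flip: I(3)\<close>)
  also have "\<dots> \<le> (\<integral>\<^sup>+ x. (\<integral>\<^sup>+ y. ennreal (r * ?F t (x(t := y)) + (1 - r)) \<partial>\<rho>) \<partial>PiM I (\<lambda>_. \<rho>))"
    by (intro nn_integral_mono inner)
  also have "\<dots> = (\<integral>\<^sup>+ z. ennreal (r * ?F t z + (1 - r)) \<partial>P)"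
    unfolding I(3) by (rule prod.product_nn_integral_insert[OF I(1,2), symmetric])
      (use F[of t] t(2) in \<open>simp flip: I(3)\<close>)
  also have "\<dots> = (\<integral>\<^sup>+ z. ennreal r * ennreal (?F t z) + ennreal (1 - r) \<partial>P)"
    using r by (intro nn_integral_cong) (simp add: ennreal_mult ennreal_plus)
  also have "\<dots> = ennreal r * (\<integral>\<^sup>+ z. ennreal (?F t z) \<partial>P) + ennreal (1 - r)"
    using F[of t] t(2) by (simp add: nn_integral_add nn_integral_cmult
        prob_space.emeasure_space_1[OF prob_space_PiM[OF prob_space_axioms]])
  also have "\<dots> \<le> ennreal r * 1 + ennreal (1 - r)"
    using step t by (intro add_mono mult_left_mono) auto
  also have "\<dots> = 1"
    using r by (simp flip: ennreal_plus)
  finally show ?case .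
qed

definition avg_sqdist :: "(nat \<Rightarrow> 'x \<times> real) \<Rightarrow> real" where
  "avg_sqdist z = (\<Sum>t = 1..T + 1. avg_weight \<gamma> T t * sqdist t z)"

lemma avg_sqdist_measurable: "avg_sqdist \<in> borel_measurable P"
  unfolding avg_sqdist_def using sqdist_measurable by (intro borel_measurable_sum borel_measurable_times) auto

lemma norm_avg_sgd_le: "(norm (avg_sgd fn k \<phi> lam \<gamma> g1 T z - opt))\<^sup>2 \<le> avg_sqdist z"
proof -
  have w: "(\<Sum>t = 1..T + 1. avg_weight \<gamma> T t) = 1" using gamma by (intro sum_avg_weight) simp
  have eq: "avg_sgd fn k \<phi> lam \<gamma> g1 T z - opt = (\<Sum>t = 1..T + 1. avg_weight \<gamma> T t *\<^sub>R (iter t z - opt))"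
    unfolding avg_sgd_def scaleR_diff_right sum_subtractf scaleR_left.sum[symmetric] w by simp
  show ?thesis
    unfolding eq avg_sqdist_def sqdist_def
  proof (rule convex_on_sum[OF _ _ convex_on_norm_square w])
    show "0 \<le> avg_weight \<gamma> T t" if "t \<in> {1..T + 1}" for t
      using that gamma by (simp add: avg_weight_def)
  qed simp_all
qed

text \<open>The prefactor turns the weighted average of distances into a uniform average of the
  exponents \<open>weight t * sqdist t z\<close>. Jensen's inequality for exp then uses only the
  separate bound for each \<open>t\<close>; no joint law of the iterates enters.\<close>

lemma avg_sqdist_exp_moment:
  "(\<integral>\<^sup>+ z. ennreal (exp (q * (2 * \<gamma> + real T) / 2 * avg_sqdist z)) \<partial>P)
    \<le> ennreal (exp (9/4 + q * (\<gamma> * (\<gamma> - 1)) * (norm (g1 - opt))\<^sup>2 / (\<gamma> + real T - 1)))"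
proof -
  define n where "n = real T + 1"
  have n: "n > 0" by (simp add: n_def)
  let ?S = "{1..T + 1}"
  define l where "l = (\<Sum>t\<in>?S. 1 / n * log_mgf_bound t)"
  have l: "l = 9/4 + q * (\<gamma> * (\<gamma> - 1)) * (norm (g1 - opt))\<^sup>2 / (\<gamma> + real T - 1)"
  proof -
    have "n * l = (\<Sum>t\<in>?S. log_mgf_bound t)"
      unfolding l_def sum_distrib_left[symmetric] using n by simp
    also have "\<dots> = n * (9/4) + q * \<gamma> * (norm (g1 - opt))\<^sup>2 * ((\<gamma> - 1) * n / (\<gamma> + real T - 1))"
      unfolding log_mgf_bound_def sum.distrib sum_distrib_left[symmetric] n_def
      using gamma by (subst sum_telescope_rational) (simp_all add: n_def)
    also have "\<dots> = n * (9/4 + q * (\<gamma> * (\<gamma> - 1)) * (norm (g1 - opt))\<^sup>2 / (\<gamma> + real T - 1))"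
      by (simp add: algebra_simps)
    finally show ?thesis using n by simp
  qed
  let ?F = "\<lambda>t z. exp (weight t * sqdist t z - log_mgf_bound t)"
  have avg: "q * (2 * \<gamma> + real T) / 2 * avg_sqdist z = (\<Sum>t\<in>?S. 1 / n * (weight t * sqdist t z))" for z
    unfolding avg_sqdist_def sum_distrib_left
  proof (rule sum.cong)
    fix t
    have "q * A / 2 * (2 * B / (A * n)) = 1 / n * (q * B)" if "A > 0" for A B
      using that by simp
    from this[of "2 * \<gamma> + real T" "\<gamma> + real t - 1"]
    have "q * (2 * \<gamma> + real T) / 2 * avg_weight \<gamma> T t = 1 / n * weight t"
      unfolding avg_weight_def weight_def n_def using gamma by simp
    then show "q * (2 * \<gamma> + real T) / 2 * (avg_weight \<gamma> T t * sqdist t z) = 1 / n * (weight t * sqdist t z)"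
      by (metis mult.assoc)
  qed simp
  have pt: "exp (q * (2 * \<gamma> + real T) / 2 * avg_sqdist z) \<le> exp l * (\<Sum>t\<in>?S. 1 / n * ?F t z)" for z
  proof -
    \<comment> \<open>Subtracting \<open>l\<close> before applying convexity leaves the normalized
      variables, whose moments are at most 1.\<close>
    have eq: "q * (2 * \<gamma> + real T) / 2 * avg_sqdist z - l
        = (\<Sum>t\<in>?S. (1 / n) *\<^sub>R (weight t * sqdist t z - log_mgf_bound t))"
      unfolding avg l_def by (simp add: right_diff_distrib sum_subtractf del: sum.cl_ivl_Suc)
    have "exp (1 * (\<Sum>t\<in>?S. (1 / n) *\<^sub>R (weight t * sqdist t z - log_mgf_bound t))) \<le> (\<Sum>t\<in>?S. 1 / n * exp (1 * (weight t * sqdist t z - log_mgf_bound t)))"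
    proof (rule convex_on_sum[OF _ _ convex_on_exp])
      show "(\<Sum>t\<in>?S. 1 / n) = 1" by (simp add: n_def del: sum.cl_ivl_Suc)
    qed (use n in simp_all)
    then show ?thesis
      unfolding eq[symmetric] by (simp add: exp_diff divide_le_eq mult.commute del: sum.cl_ivl_Suc)
  qed
  have F [measurable]: "?F s \<in> borel_measurable P" if "s \<in> ?S" for s
  proof -
    have [measurable]: "sqdist s \<in> borel_measurable P"
      using that by (intro sqdist_measurable) simp
    show ?thesis by measurable
  qed
  have "(\<integral>\<^sup>+ z. ennreal (exp (q * (2 * \<gamma> + real T) / 2 * avg_sqdist z)) \<partial>P)
      \<le> (\<integral>\<^sup>+ z. ennreal (exp l) * (\<Sum>t\<in>?S. ennreal (1 / n) * ennreal (?F t z)) \<partial>P)"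
  proof (rule nn_integral_mono)
    fix z
    have "ennreal (exp (q * (2 * \<gamma> + real T) / 2 * avg_sqdist z))
        \<le> ennreal (exp l * (\<Sum>t\<in>?S. 1 / n * ?F t z))"
      by (intro ennreal_leI pt)
    also have "\<dots> = ennreal (exp l) * (\<Sum>t\<in>?S. ennreal (1 / n) * ennreal (?F t z))"
    proof -
      have "(\<Sum>t\<in>?S. ennreal (1 / n) * ennreal (?F t z)) = (\<Sum>t\<in>?S. ennreal (1 / n * ?F t z))"
        using n by (intro sum.cong refl ennreal_mult[symmetric]) auto
      also have "\<dots> = ennreal (\<Sum>t\<in>?S. 1 / n * ?F t z)"
        using n by (intro sum_ennreal) auto
      finally show ?thesis
        using n by (simp add: ennreal_mult sum_nonneg del: sum.cl_ivl_Suc)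
    qed
    finally show "ennreal (exp (q * (2 * \<gamma> + real T) / 2 * avg_sqdist z))
        \<le> ennreal (exp l) * (\<Sum>t\<in>?S. ennreal (1 / n) * ennreal (?F t z))" .
  qed
  also have "\<dots> = ennreal (exp l) * (\<Sum>t\<in>?S. ennreal (1 / n) * (\<integral>\<^sup>+ z. ennreal (?F t z) \<partial>P))"
  proof -
    have E: "(\<lambda>z. ennreal (?F t z)) \<in> borel_measurable P" if "t \<in> ?S" for t
      using F[OF that] by measurable
    have E': "(\<lambda>z. ennreal (1 / n) * ennreal (?F t z)) \<in> borel_measurable P" if "t \<in> ?S" for t
      using E[OF that] by measurable
    have "(\<integral>\<^sup>+ z. ennreal (exp l) * (\<Sum>t\<in>?S. ennreal (1 / n) * ennreal (?F t z)) \<partial>P)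
        = ennreal (exp l) * (\<integral>\<^sup>+ z. (\<Sum>t\<in>?S. ennreal (1 / n) * ennreal (?F t z)) \<partial>P)"
      by (intro nn_integral_cmult borel_measurable_sum E')
    also have "(\<integral>\<^sup>+ z. (\<Sum>t\<in>?S. ennreal (1 / n) * ennreal (?F t z)) \<partial>P)
        = (\<Sum>t\<in>?S. (\<integral>\<^sup>+ z. ennreal (1 / n) * ennreal (?F t z) \<partial>P))"
      by (intro nn_integral_sum E')
    also have "\<dots> = (\<Sum>t\<in>?S. ennreal (1 / n) * (\<integral>\<^sup>+ z. ennreal (?F t z) \<partial>P))"
      by (intro sum.cong refl nn_integral_cmult E)
    finally show ?thesis .
  qed
  also have "\<dots> \<le> ennreal (exp l) * (\<Sum>t\<in>?S. ennreal (1 / n) * 1)"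
    by (intro mult_left_mono sum_mono sqdist_exp_moment) auto
  also have "(\<Sum>t\<in>?S. ennreal (1 / n) * 1) = 1"
  proof -
    have "(\<Sum>t\<in>?S. ennreal (1 / n) * 1) = ennreal (\<Sum>t\<in>?S. 1 / n)"
      using n by (subst sum_ennreal[symmetric]) simp_all
    also have "(\<Sum>t\<in>?S. 1 / n) = 1" by (simp add: n_def del: sum.cl_ivl_Suc)
    finally show ?thesis by simp
  qed
  finally show ?thesis by (simp add: l)
qed

end

section \<open>Classification error\<close>

text \<open>Markov's inequality in exponential form: outside the ball \<open>F\<close> is at most 1,
  hence at most \<open>exp (\<theta> * (avg_sqdist z - r\<^sup>2))\<close>.\<close>

lemma (in kernel_sgd) avg_sgd_expectation_le:
  assumes le_1: "\<And>z. F z \<le> (1::real)"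
    and le_0: "\<And>z. norm (avg_sgd fn k \<phi> lam \<gamma> g1 T z - opt) < r \<Longrightarrow> F z \<le> 0"
    and "r \<ge> 0"
  shows "(LINT z|P. F z) \<le> exp (9/4 + q * (\<gamma> * (\<gamma> - 1)) * (norm (g1 - opt))\<^sup>2 / (\<gamma> + real T - 1)
    - q * (2 * \<gamma> + real T) / 2 * r\<^sup>2)"
proof -
  define \<theta> where "\<theta> = q * (2 * \<gamma> + real T) / 2"
  define B where "B = 9/4 + q * (\<gamma> * (\<gamma> - 1)) * (norm (g1 - opt))\<^sup>2 / (\<gamma> + real T - 1)"
  have \<theta>: "\<theta> \<ge> 0" using q_pos gamma by (simp add: \<theta>_def)
  have meas: "(\<lambda>z. exp (\<theta> * avg_sqdist z)) \<in> borel_measurable P"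
    using avg_sqdist_measurable by measurable
  have le: "(\<integral>\<^sup>+ z. ennreal (exp (\<theta> * avg_sqdist z)) \<partial>P) \<le> ennreal (exp B)"
    using avg_sqdist_exp_moment unfolding \<theta>_def B_def .
  have int: "integrable P (\<lambda>z. exp (\<theta> * avg_sqdist z))"
    using meas le_less_trans[OF le ennreal_less_top] by (intro integrableI_nonneg) auto
  have "ennreal (LINT z|P. exp (\<theta> * avg_sqdist z)) \<le> ennreal (exp B)"
    using le by (subst nn_integral_eq_integral[OF int, symmetric]) auto
  then have bound: "(LINT z|P. exp (\<theta> * avg_sqdist z)) \<le> exp B"
    by (simp add: ennreal_le_iff)
  have "(LINT z|P. F z) \<le> (LINT z|P. exp (- (\<theta> * r\<^sup>2)) * exp (\<theta> * avg_sqdist z))"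
  \<comment> \<open>The majorant is integrable and non-negative, so the comparison also covers a
    non-integrable \<open>F\<close>, whose integral is 0 by convention.\<close>
  proof (rule integral_mono')
    fix z
    show "F z \<le> exp (- (\<theta> * r\<^sup>2)) * exp (\<theta> * avg_sqdist z)"
    proof (cases "norm (avg_sgd fn k \<phi> lam \<gamma> g1 T z - opt) < r")
      case True
      show ?thesis using le_0[OF True] by (rule order_trans) simp
    next
      case False
      then have "r\<^sup>2 \<le> avg_sqdist z"
        using \<open>r \<ge> 0\<close> by (intro order_trans[OF power_mono norm_avg_sgd_le]) auto
      then have "0 \<le> - (\<theta> * r\<^sup>2) + \<theta> * avg_sqdist z"
        using \<theta> by (simp add: mult_left_mono)
      then have "1 \<le> exp (- (\<theta> * r\<^sup>2) + \<theta> * avg_sqdist z)" by simp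
      then show ?thesis unfolding exp_add using le_1 by (rule order_trans[rotated])
    qed
  qed (use int in simp_all)
  also have "\<dots> = exp (- (\<theta> * r\<^sup>2)) * (LINT z|P. exp (\<theta> * avg_sqdist z))" by simp
  also have "\<dots> \<le> exp (- (\<theta> * r\<^sup>2)) * exp B" by (intro mult_left_mono bound) simp
  also have "\<dots> = exp (B - \<theta> * r\<^sup>2)" by (simp flip: exp_add)
  finally show ?thesis by (simp add: B_def \<theta>_def)
qed

section \<open>Bounds on the classification error and the margin\<close>

lemma class_error_nonneg: "class_error \<rho> f \<ge> 0"
  unfolding class_error_def zero_one_def by (intro Bochner_Integration.integral_nonneg) simp

lemma class_error_le_1:
  assumes "prob_space \<rho>"
  shows "class_error \<rho> f \<le> 1"
proof -
  have "class_error \<rho> f \<le> (LINT z|\<rho>. 1)"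
    unfolding class_error_def zero_one_def
    by (intro integral_mono' prob_space.finite_measure[OF assms] finite_measure.integrable_const) auto
  then show ?thesis by (simp add: prob_space.prob_space[OF assms])
qed

lemma margin_pos:
  assumes "0 < \<delta>" "\<delta> < 1/2" and sgn: "\<forall>t\<in>{0<..<1}. sgn (t - 1/2) = sgn (link \<phi> t)"
  shows "margin \<phi> \<delta> > 0"
proof -
  have "sgn (1/2 + \<delta> - 1/2) = sgn (link \<phi> (1/2 + \<delta>))" "sgn (1/2 - \<delta> - 1/2) = sgn (link \<phi> (1/2 - \<delta>))"
    using assms(1,2) by (intro bspec[OF sgn]; simp)+
  then have "sgn (link \<phi> (1/2 + \<delta>)) = 1" "sgn (link \<phi> (1/2 - \<delta>)) = -1" using assms(1) by auto
  then have "link \<phi> (1/2 + \<delta>) > 0" "link \<phi> (1/2 - \<delta>) \<noteq> 0" by (auto simp: sgn_if split: if_splits)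
  then show ?thesis by (simp add: margin_def)
qed

text \<open>Monotonicity compares the link with its values at \<open>1/2 + \<delta>\<close> and
  \<open>1/2 - \<delta>\<close>; multiplying by the sign treats both sides of \<open>1/2\<close> in
  one inequality.\<close>

lemma margin_le_link:
  assumes "0 < \<delta>" "\<delta> < 1/2" and sgn: "\<forall>t\<in>{0<..<1}. sgn (t - 1/2) = sgn (link \<phi> t)"
    and mono: "mono_on {0<..<1} (link \<phi>)"
    and t: "t \<in> {0<..<1}" "\<bar>t - 1/2\<bar> > \<delta>"
  shows "margin \<phi> \<delta> \<le> sgn (t - 1/2) * link \<phi> t"
proof (cases "t > 1/2")
  case True
  then have "link \<phi> (1/2 + \<delta>) \<le> link \<phi> t"
    using assms by (intro mono_onD[OF mono]) auto
  then show ?thesis using True by (simp add: margin_def)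
next
  case False
  then have "link \<phi> t \<le> link \<phi> (1/2 - \<delta>)"
    using assms by (intro mono_onD[OF mono]) auto
  moreover have "sgn (1/2 - \<delta> - 1/2) = sgn (link \<phi> (1/2 - \<delta>))"
    using assms(1,2) by (intro bspec[OF sgn]) simp
  then have "link \<phi> (1/2 - \<delta>) < 0" using assms(1) by (simp add: sgn_if split: if_splits)
  ultimately show ?thesis using False t(2) assms(1) by (simp add: margin_def)
qed

section \<open>From closeness to the regularized minimizer to optimal classification\<close>

context kernel_classification
begin

lemma class_error_cong:
  assumes [measurable]: "f \<in> borel_measurable \<X>" "g \<in> borel_measurable \<X>"
    and eq: "AE x in \<mu>. sgn (f x) = sgn (g x)"
  shows "class_error \<rho> f = class_error \<rho> g"
proof -
  have "AE z in \<rho>. sgn (f (fst z)) = sgn (g (fst z))"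
    using AE_distrD[OF fst_rho eq[unfolded marginal_def]] .
  then show ?thesis
    unfolding class_error_def zero_one_def
    by (intro integral_cong_AE) (measurable, auto)
qed

text \<open>Uniqueness of the Bayes rule, applied both to the limit \<open>g0\<close> and to the
  link composition, gives \<open>g0\<close> the right sign and modulus at least the margin.
  Evaluation costs a factor \<open>R\<close>, so a norm distance below \<open>m / R\<close> cannot
  change the sign.\<close>

lemma reg_minimizer_classifies:
  assumes margin: "AE x in \<mu>. \<bar>\<eta> x - 1/2\<bar> > \<delta>" "0 < \<delta>" "\<delta> < 1/2"
    and eta: "AE x in \<mu>. \<eta> x \<in> {0<..<1}"
    and link: "link_well_defined \<phi>" "mono_on {0<..<1} (link \<phi>)"
      "\<forall>t\<in>{0<..<1}. sgn (t - 1/2) = sgn (link \<phi> t)"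
    and bayes: "bayes_rule \<X> \<rho> \<phi> (fn h)"
    and unique: "\<And>f. bayes_rule \<X> \<rho> \<phi> f \<Longrightarrow> AE x in \<mu>. f x = fn h x"
  obtains lam0 where "lam0 > 0"
    "\<And>lam g. 0 < lam \<Longrightarrow> lam \<le> lam0 \<Longrightarrow>
      norm (g - reg_minimizer fn \<rho> \<phi> lam) < margin \<phi> \<delta> / (2 * R) \<Longrightarrow>
      class_error \<rho> (fn g) = class_error \<rho> (cond_mean \<kappa>)"
proof -
  define m where "m = margin \<phi> \<delta>"
  have m: "m > 0" unfolding m_def using margin(2,3) link(3) by (rule margin_pos)
  have min: "rkhs_risk fn \<rho> \<phi> h \<le> rkhs_risk fn \<rho> \<phi> g" for g
  proof -
    have "risk \<rho> \<phi> (fn h) \<le> risk \<rho> \<phi> (fn g)"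
      using bayes unfolding bayes_rule_def by simp
    then show ?thesis
      unfolding risk_eq_rkhs_risk by (simp add: ennreal_le_iff rkhs_risk_nonneg)
  qed
  obtain g0 where lim: "(reg_minimizer fn \<rho> \<phi> \<longlongrightarrow> g0) (at_right 0)"
    and g0: "\<And>g. rkhs_risk fn \<rho> \<phi> g0 \<le> rkhs_risk fn \<rho> \<phi> g"
    using reg_minimizer_tendsto[OF min] by blast
  have "risk \<rho> \<phi> (fn g0) \<le> risk \<rho> \<phi> (fn h)"
    unfolding risk_eq_rkhs_risk by (intro ennreal_leI g0)
  then have "bayes_rule \<X> \<rho> \<phi> (fn g0)"
    using bayes unfolding bayes_rule_def by (auto intro: order_trans)
  note g0_h = unique[OF this]
  note link_h = unique[OF link_comp_bayes_rule[OF eta link(1,2)]]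
  have g0_margin: "AE x in \<mu>. m \<le> sgn (\<eta> x - 1/2) * fn g0 x"
    using g0_h link_h eta margin(1)
  proof eventually_elim
    case (elim x)
    then have "fn g0 x = link \<phi> (\<eta> x)" by simp
    then show ?case unfolding m_def using margin_le_link[OF margin(2,3) link(3,2)] elim by simp
  qed
  \<comment> \<open>Half of the budget \<open>m / R\<close> goes to the distance from
    \<open>reg_minimizer\<close> to \<open>g0\<close>, the other half to that from \<open>g\<close>
    to \<open>reg_minimizer\<close>.\<close>
  have "m / (2 * R) > 0" using m R_pos by simp
  from tendstoD[OF lim this] obtain b where b: "b > 0"
      "\<And>lam. 0 < lam \<Longrightarrow> lam < b \<Longrightarrow> dist (reg_minimizer fn \<rho> \<phi> lam) g0 < m / (2 * R)"
    unfolding eventually_at_right_field by blast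
  show ?thesis
  \<comment> \<open>\<open>b / 2\<close> turns the strict range \<open>lam < b\<close> into a closed
    one.\<close>
  proof (rule that[of "b / 2"])
    fix lam g assume lam: "0 < lam" "lam \<le> b / 2"
      and g: "norm (g - reg_minimizer fn \<rho> \<phi> lam) < margin \<phi> \<delta> / (2 * R)"
    have "norm (g - g0) < m / R"
      using norm_triangle_ineq[of "g - reg_minimizer fn \<rho> \<phi> lam" "reg_minimizer fn \<rho> \<phi> lam - g0"]
        b(2)[of lam] g lam \<open>b > 0\<close> by (simp add: m_def dist_norm)
    then have "R * norm (g - g0) < m" using R_pos by (simp add: field_simps)
    then have near: "\<bar>fn g x - fn g0 x\<bar> < m" for x
      using fn_bound[of "g - g0" x] by (simp add: fn_diff)
    have "AE x in \<mu>. sgn (fn g x) = sgn (cond_mean \<kappa> x)"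
      using g0_margin
    proof eventually_elim
      case (elim x)
      show ?case
        using elim near[of x] m unfolding cond_mean_eq
        by (auto simp: sgn_if split: if_splits)
    qed
    moreover have "cond_mean \<kappa> \<in> borel_measurable \<X>"
      unfolding cond_mean_eq[abs_def] by measurable
    ultimately show "class_error \<rho> (fn g) = class_error \<rho> (cond_mean \<kappa>)"
      by (intro class_error_cong) measurable
  qed (use b in simp)
qed

end

section \<open>The constants of the exponential bound\<close>

theorem theorem2:
  fixes \<X> :: "'x::topological_space measure"
    and \<rho> :: "('x \<times> real) measure"
    and \<kappa> :: "'x \<Rightarrow> real measure"
    and fn :: "'h::{real_inner, complete_space} \<Rightarrow> 'x \<Rightarrow> real"
    and k :: "'x \<Rightarrow> 'x \<Rightarrow> real"
    and \<phi> :: "real \<Rightarrow> real"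
    and M L R \<delta> :: real
  assumes "space \<X> = UNIV" and "sets borel \<subseteq> sets \<X>"
    and "prob_space \<rho>" and "sets \<rho> = sets (\<X> \<Otimes>\<^sub>M count_space {-1, 1})"
    and "conditional_distribution \<X> \<rho> \<kappa>"
    and "rkhs fn k" and "case_prod k \<in> borel_measurable (\<X> \<Otimes>\<^sub>M \<X>)"
    and "\<forall>u. \<phi> u \<ge> 0" and "convex_on UNIV \<phi>" and "\<forall>u. \<phi> differentiable (at u)"
    and "M > 0" and "\<forall>\<zeta>. \<forall>y\<in>{-1, 1}. \<bar>dloss \<phi> \<zeta> y\<bar> \<le> M"
    and "L > 0" and "smooth_with (rkhs_risk fn \<rho> \<phi>) L"
    and "measure_support (marginal \<X> \<rho>) = UNIV"
    and "R > 0" and "\<forall>x. k x x \<le> R\<^sup>2"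
    and "0 < \<delta>" and "\<delta> < 1/2"
    and "AE x in marginal \<X> \<rho>. \<bar>measure (\<kappa> x) {1} - 1/2\<bar> > \<delta>"
    and "AE x in marginal \<X> \<rho>. measure (\<kappa> x) {1} \<in> {0<..<1}"
    and "link_well_defined \<phi>"
    and "\<forall>\<mu>\<in>{0<..<1}. link \<phi> differentiable (at \<mu>)"
    and "mono_on {0<..<1} (link \<phi>)" and "inj_on (link \<phi>) {0<..<1}"
    and "\<forall>\<mu>\<in>{0<..<1}. sgn (\<mu> - 1/2) = sgn (link \<phi> \<mu>)"
    and "\<forall>\<eta>1\<in>{0<..<1}. \<forall>\<eta>2\<in>{0<..<1}. bregman (min_risk \<phi>) \<eta>1 \<eta>2 = 0 \<longleftrightarrow> \<eta>1 = \<eta>2"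
    and "\<exists>g::'h. bayes_rule \<X> \<rho> \<phi> (fn g) \<and>
           (\<forall>f. bayes_rule \<X> \<rho> \<phi> f \<longrightarrow> (AE x in marginal \<X> \<rho>. f x = fn g x))"
  shows "\<exists>lam0>0. \<forall>lam. 0 < lam \<and> lam \<le> lam0 \<longrightarrow>
     (\<forall>\<gamma> (g1::'h).
        \<gamma> > 0 \<and> step_size lam \<gamma> 1 \<le> min (1 / L) (1 / (2 * lam)) \<and>
        norm g1 \<le> (2 * step_size lam \<gamma> 1 + 1 / lam) * M * R \<longrightarrow>
        (\<forall>T::nat.
           max (36 * M\<^sup>2 * R\<^sup>2 / (lam\<^sup>2 * (2 * \<gamma> + real T)))
               (\<gamma> * (\<gamma> - 1) * (norm (g1 - reg_minimizer fn \<rho> \<phi> lam))\<^sup>2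
                  / ((2 * \<gamma> + real T) * (real T + 1)))
             \<le> (margin \<phi> \<delta>)\<^sup>2 / (32 * R\<^sup>2) \<longrightarrow>
           (LINT z|PiM {1..T} (\<lambda>_. \<rho>).
              class_error \<rho> (fn (avg_sgd fn k \<phi> lam \<gamma> g1 T z)) - class_error \<rho> (cond_mean \<kappa>))
             \<le> 2 * exp (- ((margin \<phi> \<delta>)\<^sup>2 * lam\<^sup>2 * (2 * \<gamma> + real T)
                           / (2 ^ 10 * 9 * M\<^sup>2 * R ^ 4)))))"
proof -
  interpret kernel_classification \<rho> \<X> fn k \<phi> M R \<kappa>
  proof -
    interpret prob_space \<rho> by fact
    show "kernel_classification \<rho> \<X> fn k \<phi> M R \<kappa>"
      by unfold_locales (use assms in auto)
  qed
  define m where "m = margin \<phi> \<delta>"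
  have m: "m > 0" unfolding m_def using assms by (intro margin_pos) auto
  obtain h where h: "bayes_rule \<X> \<rho> \<phi> (fn h)"
    "\<And>f. bayes_rule \<X> \<rho> \<phi> f \<Longrightarrow> AE x in marginal \<X> \<rho>. f x = fn h x"
    using assms(28) by blast
  obtain lam0 where lam0: "lam0 > 0"
    "\<And>lam g. 0 < lam \<Longrightarrow> lam \<le> lam0 \<Longrightarrow> norm (g - reg_minimizer fn \<rho> \<phi> lam) < m / (2 * R) \<Longrightarrow>
      class_error \<rho> (fn g) = class_error \<rho> (cond_mean \<kappa>)"
    unfolding m_def
    by (rule reg_minimizer_classifies[of \<delta> h]) (use assms h in \<open>simp_all add: \<eta>_def\<close>)
  have "(LINT z|PiM {1..T} (\<lambda>_. \<rho>).
        class_error \<rho> (fn (avg_sgd fn k \<phi> lam \<gamma> g1 T z)) - class_error \<rho> (cond_mean \<kappa>))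
      \<le> 2 * exp (- (m\<^sup>2 * lam\<^sup>2 * (2 * \<gamma> + real T) / (2 ^ 10 * 9 * M\<^sup>2 * R ^ 4)))"
    if lam: "0 < lam" "lam \<le> lam0" and gamma: "\<gamma> > 0" "step_size lam \<gamma> 1 \<le> 1 / (2 * lam)"
      and g1: "norm g1 \<le> (2 * step_size lam \<gamma> 1 + 1 / lam) * M * R"
      and T1: "36 * M\<^sup>2 * R\<^sup>2 / (lam\<^sup>2 * (2 * \<gamma> + real T)) \<le> m\<^sup>2 / (32 * R\<^sup>2)"
      and T2: "\<gamma> * (\<gamma> - 1) * (norm (g1 - reg_minimizer fn \<rho> \<phi> lam))\<^sup>2 / ((2 * \<gamma> + real T) * (real T + 1))
        \<le> m\<^sup>2 / (32 * R\<^sup>2)"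
    for lam \<gamma> g1 and T :: nat
  proof -
    \<comment> \<open>The condition on the first step reads
      \<open>2 / (lam * (\<gamma> + 1)) \<le> 1 / (2 * lam)\<close>, that is
      \<open>4 \<le> \<gamma> + 1\<close>.\<close>
    have \<gamma>3: "\<gamma> \<ge> 3"
    proof -
      have "2 / (lam * (\<gamma> + 1)) * (2 * lam * (\<gamma> + 1)) \<le> 1 / (2 * lam) * (2 * lam * (\<gamma> + 1))"
        using gamma lam(1) by (intro mult_right_mono) (simp_all add: step_size_def)
      then show ?thesis using gamma(1) lam(1) by simp
    qed
    have "lam * norm g1 \<le> lam * ((2 * step_size lam \<gamma> 1 + 1 / lam) * M * R)"
      using lam(1) g1 by (intro mult_left_mono) auto
    \<comment> \<open>The same condition bounds
      \<open>2 * step_size lam \<gamma> 1 + 1 / lam\<close> by \<open>2 / lam\<close>.\<close>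
    also have "\<dots> \<le> lam * ((2 * (1 / (2 * lam)) + 1 / lam) * M * R)"
      using gamma(2) lam(1) M_pos R_pos by (intro mult_left_mono mult_right_mono add_right_mono) auto
    also have "\<dots> = 2 * (M * R)" using lam(1) by simp
    finally have norm_g1: "lam * norm g1 \<le> 2 * (M * R)" .
    interpret sgd: kernel_sgd \<rho> \<X> fn k \<phi> M R lam \<gamma> g1 T
      by unfold_locales (use lam \<gamma>3 norm_g1 in auto)
    \<comment> \<open>\<open>Q\<close> is the exponent without its numerical constant: the target is
      \<open>exp (- (Q / 9216))\<close>, with \<open>9216 = 2 ^ 10 * 9\<close>.\<close>
    define Q where "Q = m\<^sup>2 * lam\<^sup>2 * (2 * \<gamma> + real T) / (M\<^sup>2 * R ^ 4)"
    define A where "A = \<gamma> * (\<gamma> - 1) * (norm (g1 - reg_minimizer fn \<rho> \<phi> lam))\<^sup>2"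
    have G: "2 * \<gamma> + real T > 0" using \<gamma>3 by simp
    have q: "sgd.q = lam\<^sup>2 / (8 * M\<^sup>2 * R\<^sup>2)" by (rule sgd.q_def)
    \<comment> \<open>\<open>1152 = 36 * 32\<close>, from the first condition on
      \<open>T\<close>.\<close>
    have Q: "Q \<ge> 1152"
    proof -
      have "36 * M\<^sup>2 * R\<^sup>2 * (32 * R\<^sup>2) \<le> m\<^sup>2 * (lam\<^sup>2 * (2 * \<gamma> + real T))"
        using T1 G lam(1) R_pos by (simp add: divide_le_eq le_divide_eq mult.commute)
      then have "1152 * (M\<^sup>2 * R ^ 4) \<le> m\<^sup>2 * lam\<^sup>2 * (2 * \<gamma> + real T)"
        by (simp add: power2_eq_square power4_eq_xxxx algebra_simps)
      then show ?thesis unfolding Q_def using M_pos R_pos by (simp add: le_divide_eq)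
    qed
    have "A / (\<gamma> + real T - 1) \<le> m\<^sup>2 * (2 * \<gamma> + real T) / (32 * R\<^sup>2)"
    proof -
      define C where "C = m\<^sup>2 * (2 * \<gamma> + real T) / (32 * R\<^sup>2)"
      have C: "C \<ge> 0" using G by (simp add: C_def)
      have "A \<le> m\<^sup>2 / (32 * R\<^sup>2) * ((2 * \<gamma> + real T) * (real T + 1))"
        using T2 G unfolding A_def by (subst (asm) pos_divide_le_eq) auto
      also have "\<dots> = C * (real T + 1)" by (simp add: C_def)
      \<comment> \<open>\<open>\<gamma> \<ge> 3\<close> gives
        \<open>real T + 1 \<le> \<gamma> + real T - 1\<close>.\<close>
      also have "\<dots> \<le> C * (\<gamma> + real T - 1)" using C \<gamma>3 by (intro mult_left_mono) auto
      finally show ?thesis using \<gamma>3 unfolding C_def by (simp add: pos_divide_le_eq)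
    qed
    then have "sgd.q * (A / (\<gamma> + real T - 1)) \<le> sgd.q * (m\<^sup>2 * (2 * \<gamma> + real T) / (32 * R\<^sup>2))"
      using sgd.q_pos by (intro mult_left_mono) auto
    also have "\<dots> = Q / 256"
      unfolding q Q_def using M_pos R_pos by (simp add: field_simps power2_eq_square power4_eq_xxxx)
    finally have 1: "sgd.q * (A / (\<gamma> + real T - 1)) \<le> Q / 256" .
    have 2: "sgd.q * (2 * \<gamma> + real T) / 2 * (m / (2 * R))\<^sup>2 = Q / 64"
      unfolding q Q_def using M_pos R_pos by (simp add: field_simps power2_eq_square power4_eq_xxxx)
    have "(LINT z|PiM {1..T} (\<lambda>_. \<rho>).
        class_error \<rho> (fn (avg_sgd fn k \<phi> lam \<gamma> g1 T z)) - class_error \<rho> (cond_mean \<kappa>))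
      \<le> exp (9/4 + sgd.q * (\<gamma> * (\<gamma> - 1)) * (norm (g1 - reg_minimizer fn \<rho> \<phi> lam))\<^sup>2 / (\<gamma> + real T - 1)
          - sgd.q * (2 * \<gamma> + real T) / 2 * (m / (2 * R))\<^sup>2)"
    proof (rule sgd.avg_sgd_expectation_le)
      fix z
      show "class_error \<rho> (fn (avg_sgd fn k \<phi> lam \<gamma> g1 T z)) - class_error \<rho> (cond_mean \<kappa>) \<le> 1"
        using class_error_le_1[OF prob_space_axioms, of "fn (avg_sgd fn k \<phi> lam \<gamma> g1 T z)"]
          class_error_nonneg[of \<rho> "cond_mean \<kappa>"] by simp
      show "class_error \<rho> (fn (avg_sgd fn k \<phi> lam \<gamma> g1 T z)) - class_error \<rho> (cond_mean \<kappa>) \<le> 0"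
        if "norm (avg_sgd fn k \<phi> lam \<gamma> g1 T z - reg_minimizer fn \<rho> \<phi> lam) < m / (2 * R)"
        using lam0(2)[OF lam that] by simp
    qed (use m R_pos in simp)
    \<comment> \<open>The exponent is at most
      \<open>9/4 + Q / 256 - Q / 64 = 9/4 - 3 * Q / 256\<close>; since \<open>Q \<ge> 1152\<close>,
      this lies below \<open>- (Q / 9216)\<close>.\<close>
    also have "\<dots> \<le> exp (- (Q / 9216))"
      using 1 2 Q unfolding A_def by (simp add: mult.assoc)
    also have "\<dots> \<le> 2 * exp (- (Q / 9216))" by simp
    also have "Q / 9216 = m\<^sup>2 * lam\<^sup>2 * (2 * \<gamma> + real T) / (2 ^ 10 * 9 * M\<^sup>2 * R ^ 4)"
      by (simp add: Q_def)
    finally show ?thesis .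
  qed
  then show ?thesis
    using lam0(1) unfolding m_def by (intro exI[of _ lam0]) auto
qed

end
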